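(* Let $d \ge 2$ and let $I = (I_n)_{n\ge 1}$ be an integer sequence satisfying the Dold relations, i.e. there exist integers $a_k$, $k \ge 1$, with $I_n = \sum_{k \mid n} k\, a_k$ for every $n \ge 1$. Then there exists a continuous map $f : \mathbb{R}^d \to \mathbb{R}^d$ such that $\mathrm{Per}(f) = \mathrm{Fix}(f) = \{o\}$, where $o$ is the origin, and $i(f^n, o) = I_n$ for every $n \ge 1$.
   Context: $\mathrm{Fix}(f)$ denotes the set of fixed points of $f$ and $\mathrm{Per}(f)$ the set of periodic points of $f$. For a continuous map $g$ defined near a point $p$ which is isolated in $\mathrm{Fix}(g)$, the fixed point index $i(g,p)$ is the degree of the map $\partial B \to S^{d-1}$, $x \mapsto (x - g(x))/\|x - g(x)\|$, where $B$ is a closed ball centered at $p$ with $\mathrm{Fix}(g)\cap B = \{p\}$. (Since $o$ is the only periodic point, it is isolated in $\mathrm{Fix}(f^n)$ for each $n$, so each $i(f^n,o)$ is defined.) Equivalently, the Dold relations say $I = \sum_{k\ge1} a_k \sigma^k$ (formal sum), where $\sigma^k_n = k$ if $k \mid n$ and $\sigma^k_n = 0$ otherwise. *)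

theory Defs
  imports "HOL-Analysis.Analysis"
begin

definition Fix :: "('a \<Rightarrow> 'a) \<Rightarrow> 'a set" where
  "Fix f = {x. f x = x}"

definition Per :: "('a \<Rightarrow> 'a) \<Rightarrow> 'a set" where
  "Per f = {x. \<exists>n\<ge>1. (f ^^ n) x = x}"

text \<open>Two fixed distinct coordinate indices (exist when CARD('n) is at least 2).\<close>
definition idx_pair :: "'n::finite \<times> 'n" where
  "idx_pair = (SOME p. fst p \<noteq> snd p)"

text \<open>Standard map of degree k on the unit sphere of real^'n: the suspension of
  z \<mapsto> z^k (z the complex number formed by the two chosen coordinates),
  rescaled so as to preserve the norm.\<close>
definition std_sphere_map :: "int \<Rightarrow> real^'n::finite \<Rightarrow> real^'n" where
  "std_sphere_map k x =
     (let i = fst (idx_pair :: 'n \<times> 'n); j = snd (idx_pair :: 'n \<times> 'n);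
          z = Complex (x $ i) (x $ j);
          w = (if z = 0 then 0 else complex_of_real (cmod z) * (z / complex_of_real (cmod z)) powi k)
      in \<chi> l. if l = i then Re w else if l = j then Im w else x $ l)"

text \<open>Brouwer degree of a continuous self-map of the unit sphere S^(d-1) in real^'n,
  defined via Hopf's classification: the unique integer k such that g is homotopic
  (as a map of the sphere into the sphere) to the standard degree-k map.\<close>
definition sphere_degree :: "(real^'n::finite \<Rightarrow> real^'n) \<Rightarrow> int" where
  "sphere_degree g = (THE k. homotopic_with_canon (\<lambda>_. True) (sphere 0 1) (sphere 0 1) g (std_sphere_map k))"

text \<open>Fixed point index i(g,p): degree of x \<mapsto> (x - g x)/|x - g x| on the boundary of a
  closed ball B centred at p (radius r > 0) with Fix(g) \<inter> B = {p}; the sphere of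
  radius r is identified with the unit sphere via u \<mapsto> p + r u.\<close>
definition fp_index :: "(real^'n::finite \<Rightarrow> real^'n) \<Rightarrow> real^'n \<Rightarrow> int" where
  "fp_index g p =
     (let r = (SOME r. r > 0 \<and> Fix g \<inter> cball p r = {p})
      in sphere_degree (\<lambda>u. sgn ((p + r *\<^sub>R u) - g (p + r *\<^sub>R u))))"

end

theory Submission
  imports Defs "HOL-Homology.Homology"
begin

text \<open>The map is \<open>f (z, y) = (g z, 0)\<close> with \<open>z\<close> in a coordinate plane and \<open>g\<close> positively homogeneous, so
  the index of \<open>f ^^ n\<close> is the winding number of \<open>z - (g ^^ n) z\<close> around the origin. Writing points of
  the right half plane as \<open>x (1 + i y)\<close>, the map \<open>g\<close> multiplies \<open>x\<close> by a gain depending on \<open>y\<close> and moves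
  the direction \<open>y\<close>; where the gain vanishes \<open>g\<close> collapses the ray to the origin, which kills all
  unwanted recurrence. The winding number is 1 plus the number of repelling minus the number of
  attracting rays that are invariant under \<open>g ^^ n\<close> with total gain above 1.

  The direction \<open>0\<close> is a repelling ray with doubling dynamics on the directions in \<open>[0, 1]\<close>. Countably
  many small intervals between \<open>3/2\<close> and \<open>2\<close> are sent close to \<open>0\<close>, to height about \<open>2 ^ (1 - k)\<close>, and
  are brought back to themselves after \<open>k\<close> steps by doubling. Each gives one cycle of \<open>k\<close> invariant
  rays, attracting or repelling at will. The doubling supplies the gain needed on the way, so the
  gain on the intervals themselves may tend to 0, and this makes \<open>g\<close> continuous at their
  accumulation point although every period \<open>k\<close> occurs. As the two fixed contributions add up to 2, the Dold
  coefficients realised by the intervals are \<open>a k\<close>, diminished by 2 for \<open>k = 1\<close>.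

  That the degree is well defined, i.e. that the standard maps are pairwise non-homotopic, is seen
  on homology: suspension does not change the Brouwer degree, and on the circle the total change
  of the argument along the simplices of a chain is a cocycle which the \<open>k\<close>-th power map multiplies by \<open>k\<close>.\<close>

section \<open>Degrees of the standard sphere maps\<close>

text \<open>Lets the degree travel along isomorphisms that intertwine two self-maps, without
  choosing generators.\<close>

lemma iso_int_pow_transfer:
  fixes d :: int
  assumes "group G" "group H" and f: "f \<in> iso G H"
    and comm: "\<And>x. x \<in> carrier G \<Longrightarrow> f (a x) = b (f x)"
    and a: "\<And>x. x \<in> carrier G \<Longrightarrow> a x \<in> carrier G"
  shows "(\<forall>x\<in>carrier G. a x = x [^]\<^bsub>G\<^esub> d) \<longleftrightarrow> (\<forall>y\<in>carrier H. b y = y [^]\<^bsub>H\<^esub> d)"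
proof -
  interpret group_hom G H f
    using assms by (auto simp: group_hom_def group_hom_axioms_def iso_def)
  have inj: "inj_on f (carrier G)" and im: "f ` carrier G = carrier H"
    using f by (auto simp: iso_def bij_betw_def)
  have "a x = x [^]\<^bsub>G\<^esub> d \<longleftrightarrow> b (f x) = f x [^]\<^bsub>H\<^esub> d" if "x \<in> carrier G" for x
    using that inj_on_eq_iff[OF inj, of "a x" "x [^]\<^bsub>G\<^esub> d"] by (simp add: comm a hom_int_pow)
  then show ?thesis
    unfolding im[symmetric] by auto
qed

text \<open>As \<open>r\<close> keeps the last coordinate, it respects both hemispheres and the
  equator. Its induced maps therefore commute with three isomorphisms: the boundary map of the pair
  (upper hemisphere, equator), the inclusion of that pair into (sphere, lower hemisphere), and the
  map from the reduced homology of the sphere to this last pair. Acting as a \<open>d\<close>-th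
  power passes from one end to the other.\<close>

lemma Brouwer_degree2_suspension:
  assumes cm: "continuous_map (nsphere n) (nsphere n) r"
    and cm': "continuous_map (nsphere (Suc n)) (nsphere (Suc n)) r"
    and fixes_last: "\<And>x. r x (Suc n) = x (Suc n)"
  shows "Brouwer_degree2 (Suc n) r = Brouwer_degree2 n r"
proof -
  define p where "p = int n"
  define d where "d = Brouwer_degree2 n r"
  let ?E = "{x::nat\<Rightarrow>real. x (Suc n) = 0}" and ?L = "{x::nat\<Rightarrow>real. x (Suc n) \<le> 0}"
  let ?X = "nsphere (Suc n)"
  let ?U = "subtopology ?X {x. x (Suc n) \<ge> 0}"
  let ?R = "reduced_homology_group p (nsphere n)"
  let ?R' = "reduced_homology_group (1 + p) ?X"
  let ?G = "relative_homology_group (1 + p) ?U ?E"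
  let ?H = "relative_homology_group (1 + p) ?X ?L"
  let ?rR = "hom_induced p (nsphere n) {} (nsphere n) {} r"
  let ?rR' = "hom_induced (1 + p) ?X {} ?X {} r"
  let ?rG = "hom_induced (1 + p) ?U ?E ?U ?E r"
  let ?rH = "hom_induced (1 + p) ?X ?L ?X ?L r"
  have sub: "r \<in> ?E \<rightarrow> ?E" "r \<in> ?L \<rightarrow> ?L"
    using fixes_last by auto
  have cmU: "continuous_map ?U ?U r"
    using continuous_map_from_subtopology[OF cm'] fixes_last
    by (auto simp: continuous_map_in_subtopology)
  \<comment> \<open>Points of all spheres are functions on \<open>nat\<close> vanishing beyond the
    dimension, so the equator is literally \<open>nsphere n\<close>.\<close>
  have UE: "subtopology ?U ?E = nsphere n"
    by (simp add: subtopology_subtopology subtopology_nsphere_equator flip: Collect_conj_eq cong: rev_conj_cong)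
  have R: "\<forall>x\<in>carrier ?R. ?rR x = x [^]\<^bsub>?R\<^esub> d"
    using Brouwer_degree2 by (auto simp: d_def p_def)
  have G: "(\<forall>x\<in>carrier ?G. ?rG x = x [^]\<^bsub>?G\<^esub> d) \<longleftrightarrow> (\<forall>x\<in>carrier ?R. ?rR x = x [^]\<^bsub>?R\<^esub> d)"
  proof (rule iso_int_pow_transfer)
    show "hom_boundary (1 + p) ?U ?E \<in> iso ?G ?R"
      by (rule iso_upper_hemisphere_reduced_homology_group)
    show "hom_boundary (1 + p) ?U ?E (?rG x) = ?rR (hom_boundary (1 + p) ?U ?E x)" for x
      using fun_cong[OF naturality_hom_induced [OF cmU sub(1), of "1+p"], of x] by (simp add: UE)
  qed (auto intro: hom_induced_carrier)
  have H: "(\<forall>x\<in>carrier ?G. ?rG x = x [^]\<^bsub>?G\<^esub> d) \<longleftrightarrow> (\<forall>x\<in>carrier ?H. ?rH x = x [^]\<^bsub>?H\<^esub> d)"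
  proof (rule iso_int_pow_transfer)
    show "hom_induced (1 + p) ?U ?E ?X ?L id \<in> iso ?G ?H"
      by (rule iso_relative_homology_group_upper_hemisphere)
    have cmUX: "continuous_map ?U ?X r"
      using cm' continuous_map_from_subtopology by blast
    have "?rH \<circ> hom_induced (1 + p) ?U ?E ?X ?L id = hom_induced (1 + p) ?U ?E ?X ?L (r \<circ> id)"
      by (rule hom_induced_compose[symmetric]) (use sub cm' in auto)
    also have "\<dots> = hom_induced (1 + p) ?U ?E ?X ?L (id \<circ> r)"
      by simp
    also have "\<dots> = hom_induced (1 + p) ?U ?E ?X ?L id \<circ> ?rG"
      by (rule hom_induced_compose) (use sub cmU in auto)
    finally show "hom_induced (1 + p) ?U ?E ?X ?L id (?rG x) = ?rH (hom_induced (1 + p) ?U ?E ?X ?L id x)" for x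
      by (metis comp_apply)
  qed (auto intro: hom_induced_carrier)
  have R': "(\<forall>x\<in>carrier ?R'. ?rR' x = x [^]\<^bsub>?R'\<^esub> d) \<longleftrightarrow> (\<forall>x\<in>carrier ?H. ?rH x = x [^]\<^bsub>?H\<^esub> d)"
  proof (rule iso_int_pow_transfer)
    show "hom_induced (1 + p) ?X {} ?X ?L id \<in> iso ?R' ?H"
      using iso_reduced_homology_group_lower_hemisphere by blast
    show "hom_induced (1 + p) ?X {} ?X ?L id (?rR' x) = ?rH (hom_induced (1 + p) ?X {} ?X ?L id x)" for x
      by (simp add: hom_induced_compose' cm' sub)
  qed (auto intro: hom_induced_reduced)
  have "\<forall>x\<in>carrier ?R'. ?rR' x = x [^]\<^bsub>?R'\<^esub> d"
    using R G H R' by blast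
  then show ?thesis
    unfolding d_def[symmetric] by (intro Brouwer_degree2_unique[OF cm']) (auto simp: p_def)
qed

section \<open>Power maps of the plane and of the spheres\<close>

text \<open>The radial extension of the \<open>k\<close>-th power map of the circle; keeping the
  modulus makes it continuous at 0 for negative \<open>k\<close> too.\<close>

definition plane_pow :: "int \<Rightarrow> complex \<Rightarrow> complex" where
  "plane_pow k z = (if z = 0 then 0 else complex_of_real (cmod z) * (z / complex_of_real (cmod z)) powi k)"

lemma plane_pow_0 [simp]: "plane_pow k 0 = 0"
  by (simp add: plane_pow_def)

lemma norm_plane_pow [simp]: "cmod (plane_pow k z) = cmod z"
  by (simp add: plane_pow_def norm_mult norm_power_int norm_divide)

lemma continuous_on_plane_pow: "continuous_on UNIV (plane_pow k)"
proof -
  have "isCont (plane_pow k) z" for z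
  proof (cases "z = 0")
    case True
    have "((\<lambda>w. norm (plane_pow k w)) \<longlongrightarrow> 0) (at 0)"
      using tendsto_norm_zero[OF tendsto_ident_at, of "UNIV::complex set"] by simp
    then show ?thesis
      using True tendsto_norm_zero_cancel by (fastforce simp: isCont_def)
  next
    case False
    have "continuous_on (-{0}) (\<lambda>z. complex_of_real (cmod z) * (z / complex_of_real (cmod z)) powi k)"
      by (intro continuous_intros) auto
    then have "continuous_on (-{0}) (plane_pow k)"
      by (rule continuous_on_eq) (auto simp: plane_pow_def)
    then show ?thesis
      using False by (simp add: continuous_on_eq_continuous_at open_Compl)
  qed
  then show ?thesis
    by (simp add: continuous_at_imp_continuous_on)
qed

definition plane_proj :: "(nat \<Rightarrow> real) \<Rightarrow> complex" where
  "plane_proj x = Complex (x 0) (x 1)"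

lemma continuous_map_plane_proj: "continuous_map (nsphere n) euclidean plane_proj"
proof -
  have "continuous_map (nsphere n) euclidean (\<lambda>x. of_real (x 0) + \<i> * of_real (x 1) :: complex)"
    unfolding continuous_map_atin
    using continuous_map_nsphere_projection[of n, unfolded continuous_map_atin]
    by (auto intro!: tendsto_add tendsto_mult tendsto_const tendsto_of_real simp: limitin_canonical_iff)
  then show ?thesis
    by (simp add: plane_proj_def[abs_def] Complex_eq)
qed

text \<open>\<open>std_sphere_map\<close> in the coordinates of \<open>nsphere\<close>. One function
  serves all dimensions, so each sphere carries the suspension of the map one dimension
  below.\<close>

definition nsphere_pow :: "int \<Rightarrow> (nat \<Rightarrow> real) \<Rightarrow> nat \<Rightarrow> real" where
  "nsphere_pow k x = (let w = plane_pow k (plane_proj x) in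
     (\<lambda>l. if l = 0 then Re w else if l = 1 then Im w else x l))"

lemma plane_proj_nsphere_pow: "plane_proj (nsphere_pow k x) = plane_pow k (plane_proj x)"
  by (simp add: nsphere_pow_def plane_proj_def Let_def)

lemma continuous_map_nsphere_pow:
  assumes "n \<ge> 1"
  shows "continuous_map (nsphere n) (nsphere n) (nsphere_pow k)"
proof -
  have c: "continuous_map (nsphere n) euclidean (\<lambda>x. plane_pow k (plane_proj x))"
    using continuous_map_compose[OF continuous_map_plane_proj, of euclidean "plane_pow k"] continuous_on_plane_pow
    by (simp add: o_def)
  have cR: "continuous_map (nsphere n) euclideanreal (\<lambda>x. Re (plane_pow k (plane_proj x)))"
    using continuous_map_compose[OF c, of euclideanreal Re] continuous_on_Re[OF continuous_on_id] by (simp add: o_def)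
  have cI: "continuous_map (nsphere n) euclideanreal (\<lambda>x. Im (plane_pow k (plane_proj x)))"
    using continuous_map_compose[OF c, of euclideanreal Im] continuous_on_Im[OF continuous_on_id] by (simp add: o_def)
  have 1: "continuous_map (nsphere n) (powertop_real UNIV) (nsphere_pow k)"
    unfolding continuous_map_componentwise_UNIV nsphere_pow_def Let_def
    using cR cI continuous_map_nsphere_projection by auto
  have 2: "nsphere_pow k x \<in> topspace (nsphere n)" if x: "x \<in> topspace (nsphere n)" for x
  proof -
    have split: "(\<Sum>i\<le>n. (y i)\<^sup>2) = ((y 0)\<^sup>2 + (y 1)\<^sup>2) + (\<Sum>i\<in>{2..n}. (y i)\<^sup>2)" for y :: "nat \<Rightarrow> real"
    proof -
      have "{..n} = insert 0 (insert 1 {2..n})" using assms by auto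
      then show ?thesis by simp
    qed
    have "(cmod (plane_pow k (plane_proj x)))\<^sup>2 = (cmod (plane_proj x))\<^sup>2"
      by simp
    then have "(nsphere_pow k x 0)\<^sup>2 + (nsphere_pow k x 1)\<^sup>2 = (x 0)\<^sup>2 + (x 1)\<^sup>2"
      unfolding cmod_power2 by (simp add: nsphere_pow_def plane_proj_def Let_def)
    moreover have "(\<Sum>i\<in>{2..n}. (nsphere_pow k x i)\<^sup>2) = (\<Sum>i\<in>{2..n}. (x i)\<^sup>2)"
      by (intro sum.cong) (auto simp: nsphere_pow_def Let_def)
    ultimately have "(\<Sum>i\<le>n. (nsphere_pow k x i)\<^sup>2) = (\<Sum>i\<le>n. (x i)\<^sup>2)"
      unfolding split by simp
    moreover have "\<forall>i>n. nsphere_pow k x i = x i"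
      using assms by (auto simp: nsphere_pow_def Let_def)
    ultimately show ?thesis
      using x by (simp add: nsphere)
  qed
  show ?thesis
    using 1 2 unfolding nsphere continuous_map_in_subtopology by auto
qed

lemma Brouwer_degree2_nsphere_pow_step:
  "Brouwer_degree2 (Suc m) (nsphere_pow k) = Brouwer_degree2 1 (nsphere_pow k)"
proof (induction m)
  case (Suc m)
  have "Brouwer_degree2 (Suc (Suc m)) (nsphere_pow k) = Brouwer_degree2 (Suc m) (nsphere_pow k)"
    by (rule Brouwer_degree2_suspension) (auto intro!: continuous_map_nsphere_pow simp: nsphere_pow_def Let_def)
  with Suc show ?case by simp
qed simp

section \<open>The change of argument as a cocycle on the circle\<close>

text \<open>In effect the integral of \<open>dz / z\<close> along the path. Being defined by a lift,
  it is meaningful for continuous paths that avoid 0.\<close>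

definition log_increment :: "(real \<Rightarrow> complex) \<Rightarrow> complex" where
  "log_increment g = (SOME v. \<exists>L. continuous_on {0..1} L \<and> (\<forall>t\<in>{0..1}. g t = exp (L t)) \<and> v = L 1 - L 0)"

text \<open>Two continuous logarithms of one path differ by a continuous function with values in the
  multiples of 2 pi i, which is constant on the interval.\<close>

lemma log_increment_eq:
  assumes L: "continuous_on {0..1} L" and gL: "\<And>t. t \<in> {0..1} \<Longrightarrow> g t = exp (L t)"
  shows "log_increment g = L 1 - L 0"
proof -
  have *: "v = L 1 - L 0"
    if M: "continuous_on {0..1} M" and gM: "\<forall>t\<in>{0..1}. g t = exp (M t)" and v: "v = M 1 - M 0" for v M
  proof -
    let ?D = "\<lambda>t. M t - L t"
    have "?D constant_on {0..1}"
    proof (rule continuous_discrete_range_constant)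
      show "continuous_on {0..1} ?D"
        by (intro continuous_intros L M)
      fix x :: real assume x: "x \<in> {0..1}"
      show "\<exists>e>0. \<forall>y. y \<in> {0..1} \<and> ?D y \<noteq> ?D x \<longrightarrow> e \<le> norm (?D y - ?D x)"
      proof (intro exI[of _ 1] conjI allI impI)
        fix y :: real assume y: "y \<in> {0..1} \<and> ?D y \<noteq> ?D x"
        have "exp (?D y - ?D x) = 1"
        proof -
          have "exp (?D t) = 1" if "t \<in> {0..1}" for t
            using gL[OF that] gM that by (auto simp: exp_diff)
          then show ?thesis using x y by (simp add: exp_diff)
        qed
        then obtain n where re: "Re (?D y - ?D x) = 0" and im: "Im (?D y - ?D x) = of_int (2 * n) * pi"
          unfolding exp_eq_1 by auto
        have "n \<noteq> 0"
          using y re im by (auto simp: complex_eq_iff)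
        \<comment> \<open>Distinct multiples of 2 pi i are at distance at least 1: this is the
          discreteness that forces constancy.\<close>
        then have "1 * 1 \<le> \<bar>of_int (2 * n)\<bar> * pi"
          using pi_gt3 by (intro mult_mono) auto
        also have "\<dots> = \<bar>Im (?D y - ?D x)\<bar>"
          unfolding im by (simp add: abs_mult)
        also have "\<dots> \<le> norm (?D y - ?D x)"
          by (rule abs_Im_le_cmod)
        finally show "1 \<le> norm (?D y - ?D x)" by simp
      qed simp
    qed auto
    then have "?D 1 = ?D 0"
      unfolding constant_on_def by (metis atLeastAtMost_iff order_refl zero_le_one)
    then show ?thesis unfolding v by (simp add: diff_eq_eq add.commute add.left_commute)
  qed
  show ?thesis
    unfolding log_increment_def
    by (rule some_equality) (use * L gL in blast)+
qed

definition edge_point :: "real \<Rightarrow> nat \<Rightarrow> real" where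
  "edge_point t = (\<lambda>i. if i = 0 then 1 - t else if i = 1 then t else 0)"

definition simplex_increment :: "((nat \<Rightarrow> real) \<Rightarrow> nat \<Rightarrow> real) \<Rightarrow> complex" where
  "simplex_increment \<sigma> = log_increment (\<lambda>t. plane_proj (\<sigma> (edge_point t)))"

text \<open>The linear extension to chains, that is, a 1-cochain;
  \<open>chain_increment_boundary\<close> makes it a cocycle.\<close>

definition chain_increment :: "(nat \<Rightarrow> real) chain \<Rightarrow> complex" where
  "chain_increment c = (\<Sum>\<sigma>\<in>Poly_Mapping.keys c. of_int (Poly_Mapping.lookup c \<sigma>) * simplex_increment \<sigma>)"

text \<open>Chains with different supports can be summed over a common index set, so that linearity
  is checked termwise.\<close>

lemma chain_increment_superset:
  assumes "finite S" "Poly_Mapping.keys c \<subseteq> S"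
  shows "chain_increment c = (\<Sum>\<sigma>\<in>S. of_int (Poly_Mapping.lookup c \<sigma>) * simplex_increment \<sigma>)"
  unfolding chain_increment_def
  by (rule sum.mono_neutral_left) (use assms in \<open>auto simp: in_keys_iff\<close>)

lemma chain_increment_diff: "chain_increment (a - b) = chain_increment a - chain_increment b"
proof -
  let ?S = "Poly_Mapping.keys a \<union> Poly_Mapping.keys b"
  have "chain_increment x = (\<Sum>\<sigma>\<in>?S. of_int (Poly_Mapping.lookup x \<sigma>) * simplex_increment \<sigma>)"
    if "x \<in> {a, b, a - b}" for x
    by (rule chain_increment_superset) (use that keys_diff[of a b] in auto)
  then show ?thesis
    by (simp add: lookup_minus algebra_simps sum_subtractf)
qed

lemma chain_increment_0 [simp]: "chain_increment 0 = 0"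
  by (simp add: chain_increment_def)

lemma chain_increment_minus: "chain_increment (- a) = - chain_increment a"
  using chain_increment_diff[of 0 a] by simp

lemma chain_increment_add: "chain_increment (a + b) = chain_increment a + chain_increment b"
  using chain_increment_diff[of a "- b"] by (simp add: chain_increment_minus)

lemma chain_increment_of [simp]: "chain_increment (frag_of \<sigma>) = simplex_increment \<sigma>"
  by (simp add: chain_increment_def)

lemma chain_increment_cmul: "chain_increment (frag_cmul k c) = of_int k * chain_increment c"
proof -
  have "chain_increment (frag_cmul k c)
      = (\<Sum>\<sigma>\<in>Poly_Mapping.keys c. of_int (Poly_Mapping.lookup (frag_cmul k c) \<sigma>) * simplex_increment \<sigma>)"
    by (rule chain_increment_superset) (auto simp: keys_cmul)
  then show ?thesis
    by (simp add: chain_increment_def sum_distrib_left mult.assoc)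
qed

lemma plane_proj_nsphere_1: "x \<in> topspace (nsphere 1) \<Longrightarrow> cmod (plane_proj x) = 1"
  by (simp add: nsphere plane_proj_def cmod_def)

lemma continuous_on_singular_simplex_comp:
  fixes q :: "'a::real_normed_vector \<Rightarrow> nat \<Rightarrow> real"
  assumes "singular_simplex p (nsphere n) \<sigma>"
    and q: "\<And>i. continuous_on S (\<lambda>s. q s i)" "\<And>s. s \<in> S \<Longrightarrow> q s \<in> standard_simplex p"
  shows "continuous_on S (\<lambda>s. plane_proj (\<sigma> (q s)))"
proof -
  have 1: "continuous_map (top_of_set S) (subtopology (powertop_real UNIV) (standard_simplex p)) q"
    using q by (auto simp: continuous_map_in_subtopology continuous_map_componentwise_UNIV)
  have 2: "continuous_map (subtopology (powertop_real UNIV) (standard_simplex p)) (nsphere n) \<sigma>"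
    using assms(1) by (simp add: singular_simplex_def)
  show ?thesis
    using continuous_map_compose[OF continuous_map_compose[OF 1 2] continuous_map_plane_proj]
    by (simp add: o_def)
qed

lemma singular_simplex_in_topspace:
  assumes "singular_simplex p X \<sigma>" "x \<in> standard_simplex p"
  shows "\<sigma> x \<in> topspace X"
  using assms by (auto simp: singular_simplex_def continuous_map_def)

lemma edge_point_in_standard_simplex: "t \<in> {0..1} \<Longrightarrow> edge_point t \<in> standard_simplex 1"
  by (auto simp: standard_simplex_def edge_point_def)

lemma singular_1_simplex_log:
  assumes "singular_simplex 1 (nsphere 1) \<sigma>"
  obtains L where "continuous_on {0..1} L" "\<And>t. t \<in> {0..1} \<Longrightarrow> plane_proj (\<sigma> (edge_point t)) = exp (L t)"
proof (rule continuous_logarithm_on_contractible)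
  show "continuous_on {0..1::real} (\<lambda>t. plane_proj (\<sigma> (edge_point t)))"
  proof (rule continuous_on_singular_simplex_comp[OF assms])
    show "continuous_on {0..1} (\<lambda>s. edge_point s i)" for i
      by (cases "i = 0"; cases "i = 1") (simp_all add: edge_point_def continuous_intros)
  qed (rule edge_point_in_standard_simplex)
  show "plane_proj (\<sigma> (edge_point t)) \<noteq> 0" if "t \<in> {0..1}" for t
    using plane_proj_nsphere_1[OF singular_simplex_in_topspace[OF assms edge_point_in_standard_simplex[OF that]]]
    by auto
qed (auto intro: convex_imp_contractible)

text \<open>If \<open>L\<close> is a logarithm along the simplex, then \<open>k\<close> times
  \<open>L\<close> is one along its image, since on the unit circle \<open>plane_pow k\<close> is
  the plain \<open>k\<close>-th power.\<close>

lemma simplex_increment_nsphere_pow: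
  assumes s: "singular_simplex 1 (nsphere 1) \<sigma>"
  shows "simplex_increment (simplex_map 1 (nsphere_pow k) \<sigma>) = of_int k * simplex_increment \<sigma>"
proof -
  obtain L where L: "continuous_on {0..1} L" "\<And>t. t \<in> {0..1} \<Longrightarrow> plane_proj (\<sigma> (edge_point t)) = exp (L t)"
    using singular_1_simplex_log[OF s] by blast
  have "simplex_increment (simplex_map 1 (nsphere_pow k) \<sigma>) = of_int k * L 1 - of_int k * L 0"
    unfolding simplex_increment_def
  proof (rule log_increment_eq)
    show "continuous_on {0..1} (\<lambda>t. of_int k * L t)"
      by (intro continuous_intros L)
    fix t :: real assume t: "t \<in> {0..1}"
    have n: "cmod (plane_proj (\<sigma> (edge_point t))) = 1"
      by (rule plane_proj_nsphere_1[OF singular_simplex_in_topspace[OF s edge_point_in_standard_simplex[OF t]]])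
    have "plane_proj (simplex_map 1 (nsphere_pow k) \<sigma> (edge_point t)) = plane_pow k (plane_proj (\<sigma> (edge_point t)))"
      using edge_point_in_standard_simplex[OF t]
      by (simp add: simplex_map_def plane_proj_nsphere_pow)
    also have "\<dots> = plane_proj (\<sigma> (edge_point t)) powi k"
      using n by (auto simp: plane_pow_def)
    also have "\<dots> = exp (of_int k * L t)"
      by (simp add: L(2)[OF t] exp_power_int)
    finally show "plane_proj (simplex_map 1 (nsphere_pow k) \<sigma> (edge_point t)) = exp (of_int k * L t)" .
  qed
  moreover have "simplex_increment \<sigma> = L 1 - L 0"
    unfolding simplex_increment_def by (rule log_increment_eq[OF L])
  ultimately show ?thesis
    by (simp add: right_diff_distrib)
qed

lemma chain_increment_nsphere_pow:
  assumes "singular_chain 1 (nsphere 1) c"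
  shows "chain_increment (chain_map 1 (nsphere_pow k) c) = of_int k * chain_increment c"
  using assms unfolding singular_chain_def
proof (induction c rule: frag_induction)
  case (one x)
  then show ?case using simplex_increment_nsphere_pow[of x k] by simp
qed (auto simp: chain_map_diff chain_increment_diff algebra_simps)

text \<open>A triangle is contractible, so a single logarithm \<open>L\<close> lives on all of it,
  and the increments along the three sides telescope.\<close>

lemma chain_increment_boundary:
  assumes "singular_chain 2 (nsphere 1) c"
  shows "chain_increment (chain_boundary 2 c) = 0"
  using assms unfolding singular_chain_def
proof (induction c rule: frag_induction)
  case (one \<sigma>)
  then have s: "singular_simplex 2 (nsphere 1) \<sigma>" by simp
  \<comment> \<open>The 2-simplex is modelled by the last two of its barycentric coordinates, which
    gives a convex set \<open>T\<close> in a normed space.\<close>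
  define q :: "real \<times> real \<Rightarrow> nat \<Rightarrow> real"
    where "q = (\<lambda>(x, y) i. if i = 0 then 1 - x - y else if i = 1 then x else if i = 2 then y else 0)"
  define T where "T = {(x::real, y::real). 0 \<le> x \<and> 0 \<le> y \<and> x + y \<le> 1}"
  have q2: "q s \<in> standard_simplex 2" if "s \<in> T" for s
    using that by (auto simp: standard_simplex_def q_def T_def numeral_2_eq_2)
  have "convex T"
  proof (rule convexI)
    fix x y :: "real \<times> real" and u v :: real
    assume "x \<in> T" "y \<in> T" and uv: "0 \<le> u" "0 \<le> v" "u + v = 1"
    then obtain a b a' b' where xy: "x = (a, b)" "y = (a', b')"
      and h: "0 \<le> a" "0 \<le> b" "a + b \<le> 1" "0 \<le> a'" "0 \<le> b'" "a' + b' \<le> 1"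
      by (auto simp: T_def)
    have "0 \<le> u * a + v * a'" "0 \<le> u * b + v * b'"
      using h uv by auto
    moreover have "u * (a + b) + v * (a' + b') \<le> u * 1 + v * 1"
      using h uv by (intro add_mono mult_left_mono) auto
    then have "u * a + v * a' + (u * b + v * b') \<le> 1"
      using uv by (simp add: algebra_simps)
    ultimately show "u *\<^sub>R x + v *\<^sub>R y \<in> T"
      by (simp add: xy T_def)
  qed
  obtain L where L: "continuous_on T L" "\<And>s. s \<in> T \<Longrightarrow> plane_proj (\<sigma> (q s)) = exp (L s)"
  proof (rule continuous_logarithm_on_contractible)
    show "continuous_on T (\<lambda>s. plane_proj (\<sigma> (q s)))"
    proof (rule continuous_on_singular_simplex_comp[OF s _ q2])
      show "continuous_on T (\<lambda>s. q s i)" for i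
        by (cases "i = 0"; cases "i = 1"; cases "i = 2")
          (simp_all add: q_def case_prod_unfold continuous_intros)
    qed auto
    show "plane_proj (\<sigma> (q s')) \<noteq> 0" if "s' \<in> T" for s'
      using plane_proj_nsphere_1[OF singular_simplex_in_topspace[OF s q2[OF that]]] by auto
  qed (use \<open>convex T\<close> convex_imp_contractible in auto)
  \<comment> \<open>\<open>r\<close> runs along the side of \<open>T\<close> opposite vertex
    \<open>k\<close>; the vertices 0, 1, 2 are (0, 0), (1, 0), (0, 1).\<close>
  have face: "simplex_increment (singular_face 2 k \<sigma>) = L (r 1) - L (r 0)"
    if r: "continuous_on {0..1} r" "\<And>t. t \<in> {0..1} \<Longrightarrow> r t \<in> T"
      and e: "\<And>t. simplical_face k (edge_point t) = q (r t)" for r :: "real \<Rightarrow> real \<times> real" and k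
    unfolding simplex_increment_def
  proof (rule log_increment_eq)
    show "continuous_on {0..1} (\<lambda>t. L (r t))"
      by (rule continuous_on_compose2[OF L(1) r(1)]) (use r in auto)
    show "plane_proj (singular_face 2 k \<sigma> (edge_point t)) = exp (L (r t))" if "t \<in> {0..1}" for t
      using edge_point_in_standard_simplex[OF that] r(2)[OF that] by (simp add: singular_face_def e L(2))
  qed
  have f0: "simplex_increment (singular_face 2 0 \<sigma>) = L (0, 1) - L (1, 0)"
  proof -
    have "simplical_face 0 (edge_point t) = q (1 - t, t)" for t
      by (rule ext) (auto simp: simplical_face_def edge_point_def q_def)
    moreover have "continuous_on {0..1::real} (\<lambda>t. (1 - t, t))"
      by (intro continuous_intros)
    ultimately show ?thesis
      using face[of "\<lambda>t. (1 - t, t)" 0] by (simp add: T_def)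
  qed
  have f1: "simplex_increment (singular_face 2 1 \<sigma>) = L (0, 1) - L (0, 0)"
  proof -
    have "simplical_face 1 (edge_point t) = q (0, t)" for t
      by (rule ext) (auto simp: simplical_face_def edge_point_def q_def)
    moreover have "continuous_on {0..1::real} (\<lambda>t. (0, t))"
      by (intro continuous_intros)
    ultimately show ?thesis
      using face[of "\<lambda>t. (0, t)" 1] by (simp add: T_def)
  qed
  have f2: "simplex_increment (singular_face 2 2 \<sigma>) = L (1, 0) - L (0, 0)"
  proof -
    have "simplical_face 2 (edge_point t) = q (t, 0)" for t
      by (rule ext) (auto simp: simplical_face_def edge_point_def q_def)
    moreover have "continuous_on {0..1::real} (\<lambda>t. (t, 0))"
      by (intro continuous_intros)
    ultimately show ?thesis
      using face[of "\<lambda>t. (t, 0)" 2] by (simp add: T_def)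
  qed
  have "chain_boundary 2 (frag_of \<sigma>) = frag_of (singular_face 2 0 \<sigma>) - frag_of (singular_face 2 1 \<sigma>) + frag_of (singular_face 2 2 \<sigma>)"
    by (simp add: chain_boundary_of numeral_2_eq_2)
  then show ?case
    by (simp add: chain_increment_add chain_increment_diff f0 f1 f2 del: One_nat_def)
qed (auto simp: chain_boundary_diff chain_increment_diff)

lemma chain_increment_homologous:
  assumes "homologous_rel 1 (nsphere 1) {} a b"
  shows "chain_increment a = chain_increment b"
proof -
  obtain d where "singular_chain 2 (nsphere 1) d" "chain_boundary 2 d = a - b"
    using assms unfolding homologous_rel_def singular_boundary by (auto simp: numeral_2_eq_2)
  then show ?thesis
    using chain_increment_boundary[of d] by (simp add: chain_increment_diff)
qed

section \<open>The class of the standard loop and the degree on the circle\<close>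

text \<open>The homology group is a quotient of the cycle group, written multiplicatively; powers
  there are scalar multiples of chains.\<close>

lemma int_pow_homologous_rel_set:
  fixes d :: int
  assumes "singular_relcycle p X {} c"
  shows "homologous_rel_set p X {} c [^]\<^bsub>homology_group (int p) X\<^esub> d = homologous_rel_set p X {} (frag_cmul d c)"
proof -
  let ?C = "relcycle_group p X {}"
  interpret N: normal "singular_relboundary_set p X {}" ?C
    by (rule normal_subgroup_singular_relboundary_relcycle)
  interpret group_hom ?C "homology_group (int p) X" "homologous_rel_set p X {}"
    using N.r_coset_hom_Mod N.factorgroup_is_group
    by (simp add: group_hom_def group_hom_axioms_def right_coset_singular_relboundary nontrivial_relative_homology_group)
  have c: "c \<in> carrier ?C" using assms by simp
  have "c [^]\<^bsub>?C\<^esub> d = c [^]\<^bsub>chain_group p X\<^esub> d"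
    unfolding relcycle_group_def by (rule group.int_pow_subgroup_generated) (use c in \<open>auto simp: relcycle_group_def\<close>)
  also have "\<dots> = frag_cmul d c"
    unfolding chain_group_def
    by (rule int_pow_free_Abelian_group) (use assms in \<open>auto simp: singular_cycle singular_chain_def\<close>)
  finally show ?thesis
    using hom_int_pow[OF c, of d] by simp
qed

text \<open>One turn round the circle, driven by the second barycentric coordinate. The restriction
  is there because singular simplices must be extensional.\<close>

definition standard_loop :: "(nat \<Rightarrow> real) \<Rightarrow> nat \<Rightarrow> real" where
  "standard_loop = restrict (\<lambda>x i. if i = 0 then cos (2 * pi * x 1) else if i = 1 then sin (2 * pi * x 1) else 0)
     (standard_simplex 1)"

lemma singular_simplex_standard_loop: "singular_simplex 1 (nsphere 1) standard_loop"
proof -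
  have cx: "continuous_map (subtopology (powertop_real UNIV) (standard_simplex 1)) euclideanreal (\<lambda>x. 2 * pi * x 1)"
    by (intro continuous_map_real_mult continuous_map_from_subtopology continuous_map_product_projection) auto
  have cc: "continuous_map (subtopology (powertop_real UNIV) (standard_simplex 1)) euclideanreal (\<lambda>x. cos (2 * pi * x 1))"
    using continuous_map_compose[OF cx, of euclideanreal cos] by (simp add: o_def continuous_on_cos[OF continuous_on_id])
  have cs: "continuous_map (subtopology (powertop_real UNIV) (standard_simplex 1)) euclideanreal (\<lambda>x. sin (2 * pi * x 1))"
    using continuous_map_compose[OF cx, of euclideanreal sin] by (simp add: o_def continuous_on_sin[OF continuous_on_id])
  have "continuous_map (subtopology (powertop_real UNIV) (standard_simplex 1)) (powertop_real UNIV)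
     (\<lambda>x i. if i = 0 then cos (2 * pi * x 1) else if i = 1 then sin (2 * pi * x 1) else 0)"
    unfolding continuous_map_componentwise_UNIV using cc cs by auto
  then have "continuous_map (subtopology (powertop_real UNIV) (standard_simplex 1)) (nsphere 1)
     (\<lambda>x i. if i = 0 then cos (2 * pi * x 1) else if i = 1 then sin (2 * pi * x 1) else 0)"
    unfolding nsphere continuous_map_in_subtopology by auto
  then show ?thesis
    unfolding singular_simplex_def standard_loop_def by simp
qed

text \<open>The loop starts and ends at the same point, so its two faces agree and cancel in the
  boundary.\<close>

lemma singular_relcycle_standard_loop: "singular_relcycle 1 (nsphere 1) {} (frag_of standard_loop)"
proof -
  have mem: "(\<lambda>j. if j = i then 1 else 0) \<in> standard_simplex 1" if "i \<le> 1" for i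
    using that by simp
  have f0: "simplical_face 0 (\<lambda>j. if j = 0 then 1 else 0) = (\<lambda>j. if j = 1 then 1 else (0::real))"
    and f1: "simplical_face 1 (\<lambda>j. if j = 0 then 1 else 0) = (\<lambda>j. if j = 0 then 1 else (0::real))"
    by (auto simp: simplical_face_def)
  have "singular_face 1 0 standard_loop = singular_face 1 1 standard_loop"
  proof
    have "standard_loop (\<lambda>j. if j = 1 then 1 else 0) = standard_loop (\<lambda>j. if j = 0 then 1 else 0)"
      using mem[of 0] mem[of 1] by (simp add: standard_loop_def fun_eq_iff)
    then show "singular_face 1 0 standard_loop x = singular_face 1 1 standard_loop x" for x
      by (cases "x = (\<lambda>j. if j = 0 then 1 else 0)")
        (simp_all add: singular_face_def standard_simplex_0 f0 f1 del: One_nat_def)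
  qed
  then have "chain_boundary 1 (frag_of standard_loop) = 0"
    by (simp add: chain_boundary_of)
  then show ?thesis
    using singular_simplex_standard_loop by (simp add: singular_cycle singular_chain_of)
qed

lemma simplex_increment_standard_loop: "simplex_increment standard_loop = 2 * pi * \<i>"
proof -
  have "log_increment (\<lambda>t. plane_proj (standard_loop (edge_point t))) = 2 * pi * \<i> * of_real 1 - 2 * pi * \<i> * of_real 0"
  proof (rule log_increment_eq)
    show "continuous_on {0..1} (\<lambda>t. 2 * pi * \<i> * of_real t)"
      by (intro continuous_intros)
    show "plane_proj (standard_loop (edge_point t)) = exp (2 * pi * \<i> * of_real t)" if "t \<in> {0..1}" for t
      using edge_point_in_standard_simplex[OF that]
      by (simp add: standard_loop_def plane_proj_def edge_point_def complex_eq_iff Re_exp Im_exp)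
  qed
  then show ?thesis
    by (simp add: simplex_increment_def)
qed

text \<open>The image of the class of the loop is represented by the image chain and also by
  \<open>d\<close> times the loop. Their increments are \<open>k\<close> and \<open>d\<close> times
  2 pi i.\<close>

lemma Brouwer_degree2_nsphere_1_pow: "Brouwer_degree2 1 (nsphere_pow k) = k"
proof -
  define d where "d = Brouwer_degree2 1 (nsphere_pow k)"
  let ?c = "frag_of standard_loop" and ?X = "nsphere 1"
  let ?h = "homologous_rel_set 1 ?X {}"
  note cyc = singular_relcycle_standard_loop
  have un: "reduced_homology_group 1 (nsphere 1) = homology_group 1 (nsphere 1)"
    by (rule un_reduced_homology_group) simp
  have "?h ?c \<in> carrier (reduced_homology_group (int 1) ?X)"
    unfolding of_nat_1 un using carrier_relative_homology_group[of 1 ?X "{}"] cyc by auto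
  from Brouwer_degree2[OF this, of "nsphere_pow k"]
  have "hom_induced 1 ?X {} ?X {} (nsphere_pow k) (?h ?c) = ?h ?c [^]\<^bsub>homology_group 1 ?X\<^esub> d"
    unfolding of_nat_1 un d_def .
  also have "\<dots> = ?h (frag_cmul d ?c)"
    using int_pow_homologous_rel_set[OF cyc, of d] by simp
  also have "hom_induced 1 ?X {} ?X {} (nsphere_pow k) (?h ?c) = ?h (chain_map 1 (nsphere_pow k) ?c)"
    using hom_induced_chain_map[OF continuous_map_nsphere_pow[of 1 k] _ cyc, of "{}"] by simp
  finally have "homologous_rel 1 ?X {} (chain_map 1 (nsphere_pow k) ?c) (frag_cmul d ?c)"
    by (simp only: homologous_rel_set_eq)
  moreover have "singular_chain 1 ?X ?c"
    using cyc by (simp only: singular_cycle)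
  ultimately have "of_int k * chain_increment ?c = of_int d * chain_increment ?c"
    using chain_increment_homologous chain_increment_nsphere_pow chain_increment_cmul by metis
  then show ?thesis
    unfolding d_def[symmetric] chain_increment_of simplex_increment_standard_loop by simp
qed

lemma Brouwer_degree2_nsphere_pow:
  assumes "n \<ge> 1"
  shows "Brouwer_degree2 n (nsphere_pow k) = k"
  using Brouwer_degree2_nsphere_pow_step[of "n - 1" k] Brouwer_degree2_nsphere_1_pow[of k] assms by simp

section \<open>Transfer to the unit sphere of \<open>real^'n\<close>\<close>

lemma idx_pair_distinct:
  assumes "CARD('n::finite) \<ge> 2"
  shows "fst (idx_pair :: 'n \<times> 'n) \<noteq> snd (idx_pair :: 'n \<times> 'n)"
proof -
  obtain a b :: 'n where "a \<noteq> b"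
    using assms card_le_Suc0_iff_eq[of "UNIV :: 'n set"] by fastforce
  then have "\<exists>p :: 'n \<times> 'n. fst p \<noteq> snd p" by force
  then show ?thesis
    unfolding idx_pair_def by (rule someI_ex)
qed

lemma std_sphere_map_nth:
  fixes x :: "real^'n::finite"
  defines "i \<equiv> fst (idx_pair :: 'n \<times> 'n)" and "j \<equiv> snd (idx_pair :: 'n \<times> 'n)"
  shows "std_sphere_map k x $ l = (let w = plane_pow k (Complex (x $ i) (x $ j)) in
      if l = i then Re w else if l = j then Im w else x $ l)"
  by (simp add: std_sphere_map_def plane_pow_def Let_def i_def j_def)

text \<open>Orders the coordinates so that the chosen plane becomes the coordinates 0 and 1 on which
  \<open>nsphere_pow\<close> acts.\<close>

lemma ex_coordinate_enumeration:
  fixes i j :: "'n::finite"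
  assumes "i \<noteq> j"
  obtains \<beta> :: "'n \<Rightarrow> nat" where "bij_betw \<beta> UNIV {..CARD('n) - 1}" "\<beta> i = 0" "\<beta> j = 1"
proof -
  have card: "card {i, j} \<le> CARD('n)" by (rule card_mono) auto
  have "card (UNIV - {i, j}) = card {2..CARD('n) - 1}"
    using assms card by (subst card_Diff_subset) auto
  then obtain g where g: "bij_betw g (UNIV - {i, j}) {2..CARD('n) - 1}"
    by (metis finite finite_atLeastAtMost finite_same_card_bij)
  let ?\<beta> = "\<lambda>l. if l \<in> {i, j} then (if l = i then 0 else 1) else g l"
  have "bij_betw ?\<beta> ({i, j} \<union> (UNIV - {i, j})) ({0, 1} \<union> {2..CARD('n) - 1})"
  proof (rule bij_betw_combine)
    show "bij_betw ?\<beta> {i, j} {0, 1}"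
      using assms by (auto simp: bij_betw_def inj_on_def)
    show "bij_betw ?\<beta> (UNIV - {i, j}) {2..CARD('n) - 1}"
      using g by (rule bij_betw_cong[THEN iffD1, rotated]) auto
  qed auto
  moreover have "{0, 1} \<union> {2..CARD('n) - 1} = {..CARD('n) - 1}"
    using assms card by auto
  ultimately have "bij_betw ?\<beta> UNIV {..CARD('n) - 1}"
    by (simp add: Un_Diff_cancel)
  then show ?thesis
    by (rule that) (use assms in auto)
qed

text \<open>Renaming coordinates turns the standard maps into \<open>nsphere_pow\<close> on the
  sphere of dimension \<open>CARD('n) - 1\<close>, whose Brouwer degree is a homotopy invariant and
  equals the exponent.\<close>

lemma std_sphere_map_homotopic_imp_eq:
  assumes card: "CARD('n::finite) \<ge> 2"
    and hom: "homotopic_with_canon (\<lambda>_. True) (sphere 0 1) (sphere 0 1)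
           (std_sphere_map k :: real^'n \<Rightarrow> real^'n) (std_sphere_map l)"
  shows "k = l"
proof -
  define i where "i = fst (idx_pair :: 'n \<times> 'n)"
  define j where "j = snd (idx_pair :: 'n \<times> 'n)"
  define n where "n = CARD('n) - 1"
  have ij: "i \<noteq> j" using idx_pair_distinct[OF card] by (simp add: i_def j_def)
  obtain \<beta> :: "'n \<Rightarrow> nat" where \<beta>: "bij_betw \<beta> UNIV {..n}" "\<beta> i = 0" "\<beta> j = 1"
    using ex_coordinate_enumeration[OF ij] unfolding n_def by blast
  define \<gamma> where "\<gamma> = inv_into UNIV \<beta>"
  have \<gamma>\<beta>: "\<gamma> (\<beta> a) = a" for a
    using \<beta>(1) by (simp add: \<gamma>_def bij_betw_def)
  have \<beta>\<gamma>: "\<beta> (\<gamma> m) = m" if "m \<le> n" for m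
    using \<beta>(1) that by (simp add: \<gamma>_def bij_betw_inv_into_right)
  have \<beta>_le: "\<beta> a \<le> n" for a
    using \<beta>(1) by (auto simp: bij_betw_def)
  define e :: "(nat \<Rightarrow> real) \<Rightarrow> real^'n" where "e x = (\<chi> a. x (\<beta> a))" for x
  define e' :: "real^'n \<Rightarrow> nat \<Rightarrow> real" where "e' v = (\<lambda>m. if m \<le> n then v $ \<gamma> m else 0)" for v
  have sum_eq: "(\<Sum>a\<in>UNIV. f (\<beta> a)) = sum f {..n}" for f :: "nat \<Rightarrow> real"
    by (rule sum.reindex_bij_betw[OF \<beta>(1)])
  have norm1: "v \<in> sphere 0 1 \<longleftrightarrow> (\<Sum>a\<in>UNIV. (v $ a)\<^sup>2) = 1" for v :: "real^'n"
    by (simp add: norm_vec_def L2_set_def)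
  have ce: "continuous_map (nsphere n) (top_of_set (sphere 0 1)) e"
  proof -
    have "continuous_map (nsphere n) euclidean e"
      unfolding continuous_map_atin e_def limitin_canonical_iff
      using continuous_map_nsphere_projection[of n, unfolded continuous_map_atin]
      by (auto intro!: tendsto_vec_lambda simp: limitin_canonical_iff)
    moreover have "e x \<in> sphere 0 1" if "x \<in> topspace (nsphere n)" for x
      unfolding norm1 using that sum_eq[of "\<lambda>m. (x m)\<^sup>2"] by (simp add: e_def nsphere)
    ultimately show ?thesis
      by (auto simp: continuous_map_in_subtopology)
  qed
  have ce': "continuous_map (top_of_set (sphere 0 1)) (nsphere n) e'"
  proof -
    have "continuous_map (top_of_set (sphere 0 1)) euclideanreal (\<lambda>v. e' v m)" for m
      by (cases "m \<le> n") (simp_all add: e'_def continuous_intros)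
    moreover have "(\<Sum>m\<le>n. (e' v m)\<^sup>2) = 1" if "v \<in> sphere 0 1" for v
      using that sum_eq[of "\<lambda>m. (e' v m)\<^sup>2"] unfolding norm1 by (simp add: e'_def \<beta>_le \<gamma>\<beta>)
    ultimately show ?thesis
      by (auto simp: nsphere continuous_map_in_subtopology continuous_map_componentwise_UNIV e'_def)
  qed
  have n1: "n \<ge> 1" using card by (simp add: n_def)
  have conj: "(e' \<circ> (std_sphere_map q \<circ> e)) x = nsphere_pow q x" if "x \<in> topspace (nsphere n)" for x q
  proof
    fix m
    show "(e' \<circ> (std_sphere_map q \<circ> e)) x m = nsphere_pow q x m"
    proof (cases "m \<le> n")
      case True
      have "\<gamma> m = i \<longleftrightarrow> m = 0" "\<gamma> m = j \<longleftrightarrow> m = 1"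
        using \<beta>\<gamma>[OF True] \<beta>(2,3) \<gamma>\<beta> by metis+
      then show ?thesis
        using True \<beta> \<beta>\<gamma>[OF True]
        by (simp add: e'_def std_sphere_map_nth e_def nsphere_pow_def plane_proj_def Let_def flip: i_def j_def)
    next
      case False
      then show ?thesis
        using that n1 by (simp add: e'_def nsphere_pow_def Let_def nsphere)
    qed
  qed
  have "homotopic_with (\<lambda>_. True) (nsphere n) (nsphere n) (e' \<circ> (std_sphere_map k \<circ> e)) (e' \<circ> (std_sphere_map l \<circ> e))"
    by (rule homotopic_with_compose_continuous_map_left[OF
          homotopic_with_compose_continuous_map_right[OF hom ce] ce']) auto
  moreover have "Brouwer_degree2 n (e' \<circ> (std_sphere_map q \<circ> e)) = Brouwer_degree2 n (nsphere_pow q)" for q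
    by (rule Brouwer_degree2_eq) (rule conj)
  ultimately have "Brouwer_degree2 n (nsphere_pow k) = Brouwer_degree2 n (nsphere_pow l)"
    using Brouwer_degree2_homotopic by force
  then show ?thesis
    using Brouwer_degree2_nsphere_pow[OF n1] by simp
qed

text \<open>Two standard maps homotopic to \<open>g\<close> are homotopic to each other, so the
  definite description is unique.\<close>

lemma sphere_degree_eqI:
  assumes "CARD('n::finite) \<ge> 2"
    and "homotopic_with_canon (\<lambda>_. True) (sphere 0 1) (sphere 0 1) (g :: real^'n \<Rightarrow> real^'n) (std_sphere_map k)"
  shows "sphere_degree g = k"
  unfolding sphere_degree_def
proof (rule the_equality)
  show "l = k" if "homotopic_with_canon (\<lambda>_. True) (sphere 0 1) (sphere 0 1) g (std_sphere_map l)" for l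
    using std_sphere_map_homotopic_imp_eq[OF assms(1) homotopic_with_trans[OF homotopic_with_symD[OF that] assms(2)]] .
qed (rule assms(2))

section \<open>Winding of plane displacement fields\<close>

lemma isCont_eventually_eqI:
  "eventually (\<lambda>x. f x = g x) (nhds a) \<Longrightarrow> isCont g a \<Longrightarrow> isCont f a"
  by (simp add: isCont_cong)

text \<open>At a point of \<open>P\<close> the curve crosses the negative real axis, so there the logarithm of \<open>- q\<close>,
  suitably shifted, continues the principal branch.\<close>

lemma crossing_log:
  fixes q :: "real \<Rightarrow> complex" and s :: "real \<Rightarrow> int"
  assumes cont: "continuous_on UNIV q" and P: "finite P"
    and off: "\<And>\<tau>. \<tau> \<notin> P \<Longrightarrow> q \<tau> \<notin> \<real>\<^sub>\<le>\<^sub>0"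
    and on: "\<And>p. p \<in> P \<Longrightarrow> Im (q p) = 0 \<and> Re (q p) < 0"
    and s: "\<And>p. p \<in> P \<Longrightarrow> s p = 1 \<or> s p = - 1"
    and cross: "\<And>p. p \<in> P \<Longrightarrow> eventually (\<lambda>\<tau>. of_int (s p) * (\<tau> - p) * Im (q \<tau>) \<le> 0) (nhds p)"
  obtains Q where "continuous_on UNIV Q" "\<And>\<tau>. exp (Q \<tau>) = q \<tau>"
    "\<And>\<tau>. q \<tau> = 1 \<Longrightarrow> (\<And>p. p \<in> P \<Longrightarrow> \<tau> < p) \<Longrightarrow> Q \<tau> = 0"
    "\<And>\<tau>. q \<tau> = 1 \<Longrightarrow> (\<And>p. p \<in> P \<Longrightarrow> p < \<tau>) \<Longrightarrow> Q \<tau> = 2 * pi * \<i> * of_int (sum s P)"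
proof
  define S where "S \<tau> = sum s {p\<in>P. p < \<tau>}" for \<tau>
  \<comment> \<open>\<open>S\<close> counts, with sign, the crossings strictly to the left, and
    \<open>c\<close> turns the count into a shift of the principal branch. A crossing with
    \<open>s p = 1\<close> goes from the upper to the lower half plane, hence counterclockwise, and
    \<open>Ln\<close> drops by 2 pi i there.\<close>
  define c where "c n = complex_of_real (2 * pi) * \<i> * of_int n" for n :: int
  define Q where "Q \<tau> = (if \<tau> \<in> P then Ln (- q \<tau>) + \<i> * pi * of_int (s \<tau>) + c (S \<tau>) else Ln (q \<tau>) + c (S \<tau>))" for \<tau>
  have c_add: "c (m + n) = c m + c n" for m n
    by (simp add: c_def algebra_simps)
  have exp_c: "exp (c n) = 1" for n
    using exp_integer_2pi[of "of_int n"] by (simp add: c_def mult_ac)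
  have q0: "q \<tau> \<noteq> 0" for \<tau>
    using off[of \<tau>] on[of \<tau>] by (cases "\<tau> \<in> P") auto
  show "exp (Q \<tau>) = q \<tau>" for \<tau>
  proof (cases "\<tau> \<in> P")
    case True
    have "exp (\<i> * pi * of_int (s \<tau>)) = - 1"
      using s[OF True] by (auto simp: exp_minus)
    then show ?thesis
      using True q0[of \<tau>] by (simp add: Q_def exp_add exp_c)
  next
    case False
    then show ?thesis using q0[of \<tau>] by (simp add: Q_def exp_add exp_c)
  qed
  show "Q \<tau> = 0" if "q \<tau> = 1" "\<And>p. p \<in> P \<Longrightarrow> \<tau> < p" for \<tau>
  proof -
    have *: "{p\<in>P. p < \<tau>} = {}" and "\<tau> \<notin> P" using that(2) by force+
    then show ?thesis using that(1) unfolding Q_def S_def * by (simp add: c_def)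
  qed
  show "Q \<tau> = 2 * pi * \<i> * of_int (sum s P)" if "q \<tau> = 1" "\<And>p. p \<in> P \<Longrightarrow> p < \<tau>" for \<tau>
  proof -
    have *: "{p\<in>P. p < \<tau>} = P" and "\<tau> \<notin> P" using that(2) by force+
    then show ?thesis using that(1) unfolding Q_def S_def * by (simp add: c_def)
  qed
  have isC: "isCont q \<tau>" for \<tau>
    using cont by (simp add: continuous_on_eq_continuous_at)
  \<comment> \<open>Near \<open>\<tau>0\<close> no other point of \<open>P\<close> is met or passed,
    so \<open>S\<close> can change only by the contribution of \<open>\<tau>0\<close>
    itself.\<close>
  have loc: "eventually (\<lambda>\<tau>. \<forall>p\<in>P - {\<tau>0}. (p < \<tau>) = (p < \<tau>0) \<and> p \<noteq> \<tau>) (nhds \<tau>0)" for \<tau>0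
  proof (rule eventually_ball_finite)
    show "\<forall>p\<in>P - {\<tau>0}. eventually (\<lambda>\<tau>. (p < \<tau>) = (p < \<tau>0) \<and> p \<noteq> \<tau>) (nhds \<tau>0)"
    proof
      fix p assume p: "p \<in> P - {\<tau>0}"
      show "eventually (\<lambda>\<tau>. (p < \<tau>) = (p < \<tau>0) \<and> p \<noteq> \<tau>) (nhds \<tau>0)"
      proof (cases "p < \<tau>0")
        case True
        then have "eventually (\<lambda>\<tau>. \<tau> \<in> {p<..}) (nhds \<tau>0)"
          by (intro eventually_nhds_in_open) auto
        then show ?thesis by eventually_elim (use True in auto)
      next
        case False
        then have "eventually (\<lambda>\<tau>. \<tau> \<in> {..<p}) (nhds \<tau>0)"
          using p by (intro eventually_nhds_in_open) auto
        then show ?thesis by eventually_elim (use False in auto)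
      qed
    qed
  qed (use P in auto)
  have "isCont Q \<tau>0" for \<tau>0
  proof (cases "\<tau>0 \<in> P")
    case False
    have "eventually (\<lambda>\<tau>. Q \<tau> = Ln (q \<tau>) + c (S \<tau>0)) (nhds \<tau>0)"
      using loc[of \<tau>0]
    proof eventually_elim
      case (elim \<tau>)
      then have "{p\<in>P. p < \<tau>} = {p\<in>P. p < \<tau>0}" "\<tau> \<notin> P" using False by auto
      then show ?case by (simp add: Q_def S_def)
    qed
    moreover have "isCont (\<lambda>\<tau>. Ln (q \<tau>) + c (S \<tau>0)) \<tau>0"
      using off[OF False] isC[of \<tau>0] by (intro continuous_intros) auto
    ultimately show ?thesis
      by (rule isCont_eventually_eqI)
  next
    case True
    let ?F = "\<lambda>\<tau>. Ln (- q \<tau>) + \<i> * pi * of_int (s \<tau>0) + c (S \<tau>0)"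
    have "eventually (\<lambda>\<tau>. Re (q \<tau>) < 0) (nhds \<tau>0)"
      using isC[of \<tau>0] on[OF True] unfolding isCont_def
      by (metis continuous_within isC order_tendstoD(2) tendsto_Re tendsto_at_iff_tendsto_nhds)
    then have "eventually (\<lambda>\<tau>. Q \<tau> = ?F \<tau>) (nhds \<tau>0)"
      using loc[of \<tau>0] cross[OF True]
    proof eventually_elim
      case (elim \<tau>)
      have same: "p < \<tau> \<longleftrightarrow> p < \<tau>0" "p \<noteq> \<tau>" if "p \<in> P" "p \<noteq> \<tau>0" for p
        using elim(2) that by blast+
      have sgn: "(\<tau> - \<tau>0) * (of_int (s \<tau>0) * Im (q \<tau>)) \<le> 0"
        using elim(3) by (simp add: mult_ac)
      consider "\<tau> = \<tau>0" | "\<tau> < \<tau>0" | "\<tau> > \<tau>0" by linarith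
      then show ?case
      proof cases
        case 1
        then show ?thesis using True by (simp add: Q_def)
      next
        case 2
        then have "{p\<in>P. p < \<tau>} = {p\<in>P. p < \<tau>0}"
          using same(1) by (intro Collect_cong) (metis less_asym less_irrefl)
        then have S: "S \<tau> = S \<tau>0" by (simp add: S_def)
        have n: "\<tau> \<notin> P" using same(2) 2 by blast
        have im: "Im (q \<tau>) \<noteq> 0"
          using off[OF n] elim(1) by (auto simp: complex_nonpos_Reals_iff)
        have "0 \<le> of_int (s \<tau>0) * Im (q \<tau>)"
          using sgn 2 by (simp add: mult_le_0_iff)
        then have "Ln (- q \<tau>) = Ln (q \<tau>) - \<i> * pi * of_int (s \<tau>0)"
          using s[OF True] im q0[of \<tau>] by (auto simp: Ln_minus)
        then show ?thesis using n by (simp add: Q_def S)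
      next
        case 3
        then have "{p\<in>P. p < \<tau>} = {p\<in>P. p = \<tau>0 \<or> p < \<tau>0}"
          using same(1) by (intro Collect_cong) metis
        also have "\<dots> = insert \<tau>0 {p\<in>P. p < \<tau>0}"
          using True by auto
        finally have S: "S \<tau> = s \<tau>0 + S \<tau>0" using P by (simp add: S_def)
        have n: "\<tau> \<notin> P" using same(2) 3 by blast
        have im: "Im (q \<tau>) \<noteq> 0"
          using off[OF n] elim(1) by (auto simp: complex_nonpos_Reals_iff)
        have "of_int (s \<tau>0) * Im (q \<tau>) \<le> 0"
          using sgn 3 by (simp add: mult_le_0_iff)
        then have "Ln (- q \<tau>) = Ln (q \<tau>) + \<i> * pi * of_int (s \<tau>0)"
          using s[OF True] im q0[of \<tau>] by (auto simp: Ln_minus)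
        then show ?thesis using n by (simp add: Q_def S c_add) (simp add: c_def)
      qed
    qed
    moreover have "isCont ?F \<tau>0"
      using on[OF True] isC[of \<tau>0] by (intro continuous_intros) (auto simp: complex_nonpos_Reals_iff)
    ultimately show ?thesis
      by (rule isCont_eventually_eqI)
  qed
  then show "continuous_on UNIV Q"
    by (simp add: continuous_at_imp_continuous_on)
qed

section \<open>Homotopies from plane fields to power maps and their suspensions\<close>

text \<open>\<open>L\<close> is a logarithm of the field divided by \<open>z\<close>. Both
  \<open>L\<close> and \<open>\<i> * N * Arg z\<close> drop by 2 pi i \<open>N\<close> when the
  negative real axis is crossed downwards, so the exponential of any convex combination of them is
  continuous there. The factor \<open>z\<close> adds one turn, whence \<open>N + 1\<close>.\<close>

lemma plane_homotopy:
  fixes Q :: "real \<Rightarrow> complex" and N :: int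
  assumes contQ: "continuous_on UNIV Q" and C: "C > 0"
    and Q_left: "\<And>\<tau>. \<tau> \<le> - C \<Longrightarrow> Q \<tau> = 0" and Q_right: "\<And>\<tau>. \<tau> \<ge> C \<Longrightarrow> Q \<tau> = 2 * pi * \<i> * of_int N"
  shows "\<exists>h :: real \<times> complex \<Rightarrow> complex. continuous_on ({0..1} \<times> UNIV) h \<and>
    (\<forall>t z. h (t, z) = 0 \<longleftrightarrow> z = 0) \<and>
    (\<forall>z. h (0, z) = (if Re z > 0 then z * exp (Q (Im z / Re z)) else z)) \<and>
    (\<forall>z. h (1, z) = plane_pow (N + 1) z)"
proof -
  \<comment> \<open>On the negative real axis \<open>L\<close> takes its value from above, in
    accordance with \<open>Arg\<close>, which is pi there.\<close>
  define L where "L z = (if Re z > 0 then Q (Im z / Re z) else if Im z \<ge> 0 then 2 * pi * \<i> * of_int N else 0)" for z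
  define e where "e = (\<lambda>(t, z). exp (of_real (1 - t) * L z + of_real t * (\<i> * of_int N * of_real (Arg z))))"
  define h where "h = (\<lambda>(t, z). z * e (t, z))"
  have exp_N: "exp (2 * of_real pi * \<i> * of_int N) = 1"
    using exp_integer_2pi[of "of_int N"] by (simp add: mult_ac)
  have h_zero: "h (t, z) = 0 \<longleftrightarrow> z = 0" for t z
    by (simp add: h_def e_def)
  have h_0: "h (0, z) = (if Re z > 0 then z * exp (Q (Im z / Re z)) else z)" for z
    by (simp add: h_def e_def L_def exp_N)
  have h_1: "h (1, z) = plane_pow (N + 1) z" for z
  proof (cases "z = 0")
    case False
    have "z / of_real (cmod z) = exp (\<i> * of_real (Arg z))"
      using False Arg_eq[of z] by (simp add: field_simps)
    then have *: "(z / of_real (cmod z)) powi N = exp (\<i> * of_int N * of_real (Arg z))"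
      by (simp add: exp_power_int mult_ac)
    have "plane_pow (N + 1) z = of_real (cmod z) * ((z / of_real (cmod z)) powi N * (z / of_real (cmod z)))"
      using False by (simp add: plane_pow_def power_int_add_1)
    also have "\<dots> = z * exp (\<i> * of_int N * of_real (Arg z))"
      using False by (simp add: *)
    finally show ?thesis by (simp add: h_def e_def)
  qed (simp add: h_def)
  have L_cont: "isCont L z" if z: "z \<notin> \<real>\<^sub>\<le>\<^sub>0" for z
  proof -
    \<comment> \<open>The last two regions reach across the imaginary axis; their points in the
      right half plane have slope beyond \<open>C\<close>, so \<open>L\<close> is constant on
      each.\<close>
    consider "Re z > 0" | "Im z > 0 \<and> Im z > C * Re z" | "Im z < 0 \<and> Im z < - C * Re z"
    proof (cases "Re z > 0")
      case False
      have "Im z \<noteq> 0" using False z by (auto simp: complex_nonpos_Reals_iff)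
      moreover have "C * Re z \<le> 0" using False C by (simp add: mult_nonneg_nonpos)
      ultimately show ?thesis using that(2,3) by linarith
    qed
    then show ?thesis
    proof cases
      case 1
      have "eventually (\<lambda>w. w \<in> {w. Re w > 0}) (nhds z)"
        using 1 by (intro eventually_nhds_in_open) (auto simp: open_halfspace_Re_gt)
      then have "eventually (\<lambda>w. L w = Q (Im w / Re w)) (nhds z)"
        by eventually_elim (simp add: L_def)
      moreover have "isCont Q (Im z / Re z)"
        using contQ by (simp add: continuous_on_eq_continuous_at)
      then have "isCont (\<lambda>w. Q (Im w / Re w)) z"
        by (rule isCont_o2[where f = "\<lambda>w. Im w / Re w", rotated]) (use 1 in \<open>auto intro!: continuous_intros\<close>)
      ultimately show ?thesis by (rule isCont_eventually_eqI)
    next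
      case 2
      have "open {w. Im w > 0 \<and> Im w > C * Re w}"
        by (intro open_Collect_conj open_Collect_less continuous_intros)
      then have "eventually (\<lambda>w. w \<in> {w. Im w > 0 \<and> Im w > C * Re w}) (nhds z)"
        using 2 by (intro eventually_nhds_in_open) auto
      then have "eventually (\<lambda>w. L w = 2 * pi * \<i> * of_int N) (nhds z)"
      proof eventually_elim
        case (elim w)
        then show ?case by (auto simp: L_def pos_le_divide_eq Q_right)
      qed
      then show ?thesis by (rule isCont_eventually_eqI) (rule continuous_const)
    next
      case 3
      have "open {w. Im w < 0 \<and> Im w < - C * Re w}"
        by (intro open_Collect_conj open_Collect_less continuous_intros)
      then have "eventually (\<lambda>w. w \<in> {w. Im w < 0 \<and> Im w < - C * Re w}) (nhds z)"
        using 3 by (intro eventually_nhds_in_open) auto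
      then have "eventually (\<lambda>w. L w = 0) (nhds z)"
      proof eventually_elim
        case (elim w)
        then show ?case by (auto simp: L_def pos_divide_le_eq Q_left)
      qed
      then show ?thesis by (rule isCont_eventually_eqI) (rule continuous_const)
    qed
  qed
  have e_cont: "isCont e (t, z)" if z: "z \<noteq> 0" for t z
  proof (cases "z \<in> \<real>\<^sub>\<le>\<^sub>0")
    case False
    have "isCont (\<lambda>x. L (snd x)) (t, z)" "isCont (\<lambda>x. Arg (snd x)) (t, z)"
      by (rule isCont_o2[where f = snd]; simp add: L_cont[OF False] continuous_at_Arg[OF False])+
    then show ?thesis
      unfolding e_def case_prod_unfold by (intro continuous_intros)
  next
    case True
    have re: "Re z < 0" using True z by (auto simp: complex_nonpos_Reals_iff complex_eq_iff)
    \<comment> \<open>\<open>Arg (- w)\<close> is continuous near the negative axis. Expressed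
      through it, the exponent of \<open>e\<close> agrees with that of \<open>?G\<close> below the
      axis and exceeds it by 2 pi i \<open>N\<close> above.\<close>
    let ?G = "\<lambda>x. exp (of_real (fst x) * (\<i> * of_int N * (of_real (Arg (- snd x)) - of_real pi)))"
    have "open {x::real \<times> complex. Re (snd x) < 0}"
      by (intro open_Collect_less continuous_intros)
    then have "eventually (\<lambda>x. x \<in> {x::real \<times> complex. Re (snd x) < 0}) (nhds (t, z))"
      using re by (intro eventually_nhds_in_open) auto
    then have ev: "eventually (\<lambda>x. e x = ?G x) (nhds (t, z))"
    proof eventually_elim
      case (elim x)
      obtain t' w where x: "x = (t', w)" by force
      have w: "w \<noteq> 0" "Re w < 0" using elim x by auto
      show ?case
      proof (cases "Im w \<ge> 0")
        case True
        have A: "Arg w = Arg (- w) + pi"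
          using Arg_minus[of w] Arg_less_0[of w] Arg_eq_0[of w] w True by (auto simp: split: if_splits)
        have "e x = exp (2 * pi * \<i> * of_int N + of_real t' * (\<i> * of_int N * (of_real (Arg (- w)) - of_real pi)))"
          using w True by (simp add: x e_def L_def A algebra_simps)
        then show ?thesis by (simp add: exp_add exp_N x)
      next
        case False
        have A: "Arg w = Arg (- w) - pi"
          using Arg_minus[of w] Arg_less_0[of w] w False by (auto split: if_splits)
        show ?thesis
          using w False by (simp add: x e_def L_def A)
      qed
    qed
    have arg: "isCont (\<lambda>x. Arg (- snd x)) (t, z)"
    proof (rule isCont_o2[where f = "\<lambda>x. - snd x"])
      show "isCont Arg (- snd (t, z))"
        using re by (intro continuous_at_Arg) (simp add: complex_nonpos_Reals_iff)
    qed (intro continuous_intros)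
    have "isCont ?G (t, z)"
      by (intro continuous_intros arg)
    with ev show ?thesis by (rule isCont_eventually_eqI)
  qed
  \<comment> \<open>A bound on \<open>Q\<close> bounds the factor \<open>e\<close>, which yields
    continuity of \<open>h\<close> at \<open>z = 0\<close>, where \<open>L\<close> may have no
    limit.\<close>
  obtain B where B: "\<And>\<tau>. norm (Q \<tau>) \<le> B"
  proof -
    have "compact (Q ` {- C..C})"
      using contQ by (intro compact_continuous_image) (auto intro: continuous_on_subset)
    then have "bounded (Q ` {- C..C})"
      by (rule compact_imp_bounded)
    then obtain b where b: "\<forall>x\<in>Q ` {- C..C}. norm x \<le> b"
      unfolding bounded_iff by (elim exE)
    have "norm (Q \<tau>) \<le> b" for \<tau>
    proof -
      obtain \<sigma> where "\<sigma> \<in> {- C..C}" "Q \<tau> = Q \<sigma>"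
      proof -
        consider "\<tau> \<le> - C" | "\<tau> \<ge> C" | "\<tau> \<in> {- C..C}" by force
        then show ?thesis
        proof cases
          case 1
          then show ?thesis using that[of "- C"] C by (simp add: Q_left)
        next
          case 2
          then show ?thesis using that[of C] C by (simp add: Q_right)
        qed (use that in blast)
      qed
      then show ?thesis using b by simp
    qed
    then show ?thesis using that by blast
  qed
  have B0: "B \<ge> 0" using B[of 0] norm_ge_zero order_trans by blast
  have h_bound: "cmod (h (t, z)) \<le> exp B * cmod z" if "t \<in> {0..1}" for t z
  proof -
    have "Re (L z) \<le> B"
      using B[of "Im z / Re z"] abs_Re_le_cmod[of "Q (Im z / Re z)"] B0 by (auto simp: L_def)
    then have "(1 - t) * Re (L z) \<le> (1 - t) * B"
      using that by (intro mult_left_mono) auto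
    also have "\<dots> \<le> B"
      using that B0 by (simp add: mult_left_le_one_le)
    finally have "cmod (e (t, z)) \<le> exp B"
      by (simp add: e_def)
    then show ?thesis
      by (simp add: h_def norm_mult mult.commute mult_left_mono)
  qed
  have "continuous_on ({0..1} \<times> UNIV) h"
    unfolding continuous_on_eq_continuous_within
  proof
    fix x :: "real \<times> complex" assume x: "x \<in> {0..1} \<times> UNIV"
    obtain t z where tz: "x = (t, z)" by force
    show "continuous (at x within {0..1} \<times> UNIV) h"
    proof (cases "z = 0")
      case False
      have "isCont (\<lambda>x. snd x * e x) (t, z)"
        by (intro continuous_intros e_cont False)
      then have "isCont h x" by (simp add: h_def tz case_prod_unfold)
      then show ?thesis by (rule continuous_at_imp_continuous_at_within)
    next
      case True
      have "((\<lambda>y. exp B * cmod (snd y)) \<longlongrightarrow> exp B * cmod (snd x)) (at x within {0..1} \<times> UNIV)"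
        by (intro tendsto_intros)
      then have "((\<lambda>y. exp B * cmod (snd y)) \<longlongrightarrow> 0) (at x within {0..1} \<times> UNIV)"
        by (simp add: tz True)
      moreover have "eventually (\<lambda>y. norm (h y) \<le> exp B * cmod (snd y)) (at x within {0..1} \<times> UNIV)"
        unfolding eventually_at_filter using h_bound by (auto intro!: always_eventually)
      ultimately have "(h \<longlongrightarrow> 0) (at x within {0..1} \<times> UNIV)"
        by (rule Lim_null_comparison[rotated])
      then show ?thesis by (simp add: continuous_within tz True h_def)
    qed
  qed
  then show ?thesis
    using h_zero h_0 h_1 by (intro exI[of _ h] conjI allI)
qed

text \<open>The common form of the standard sphere maps and of the displacement fields of maps that
  act on the chosen plane and kill all other coordinates.\<close>

definition plane_suspension :: "(complex \<Rightarrow> complex) \<Rightarrow> real^'n::finite \<Rightarrow> real^'n" where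
  "plane_suspension u x =
     (let i = fst (idx_pair :: 'n \<times> 'n); j = snd (idx_pair :: 'n \<times> 'n); w = u (Complex (x $ i) (x $ j))
      in \<chi> l. if l = i then Re w else if l = j then Im w else x $ l)"

lemma std_sphere_map_eq: "std_sphere_map k = plane_suspension (plane_pow k)"
  by (simp add: fun_eq_iff std_sphere_map_def plane_suspension_def plane_pow_def Let_def)

text \<open>As \<open>h\<close> vanishes only for \<open>z = 0\<close> and the other coordinates
  stay put, the suspended homotopy has no zero on the sphere and can be normalised.\<close>

lemma homotopic_plane_suspension:
  fixes u v :: "complex \<Rightarrow> complex" and h :: "real \<times> complex \<Rightarrow> complex"
  assumes distinct: "fst (idx_pair :: 'n::finite \<times> 'n) \<noteq> snd (idx_pair :: 'n \<times> 'n)"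
    and conth: "continuous_on ({0..1} \<times> UNIV) h" and nz: "\<And>t z. h (t, z) = 0 \<longleftrightarrow> z = 0"
    and h0: "\<And>z. h (0, z) = u z" and h1: "\<And>z. h (1, z) = v z"
  shows "homotopic_with_canon (\<lambda>_. True) (sphere 0 1) (sphere 0 1)
           (\<lambda>x :: real^'n. sgn (plane_suspension u x)) (\<lambda>x. sgn (plane_suspension v x))"
proof -
  let ?i = "fst (idx_pair :: 'n \<times> 'n)" and ?j = "snd (idx_pair :: 'n \<times> 'n)"
  define H where "H = (\<lambda>(t, x :: real^'n). plane_suspension (\<lambda>z. h (t, z)) x)"
  let ?S = "{0..1} \<times> sphere (0 :: real^'n) 1"
  have nth: "plane_suspension u x $ l = (let w = u (Complex (x $ ?i) (x $ ?j)) in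
      if l = ?i then Re w else if l = ?j then Im w else x $ l)" for u and x :: "real^'n" and l
    by (simp add: plane_suspension_def Let_def)
  have contw: "continuous_on ?S (\<lambda>y. h (fst y, Complex (snd y $ ?i) (snd y $ ?j)))"
    unfolding Complex_eq
    by (intro continuous_on_compose2[OF conth] continuous_intros) auto
  have "continuous_on ?S H"
    unfolding H_def case_prod_unfold
  proof (rule continuous_on_vec_lambda[THEN continuous_on_eq])
    fix l
    show "continuous_on ?S (\<lambda>y. if l = ?i then Re (h (fst y, Complex (snd y $ ?i) (snd y $ ?j))) else
       if l = ?j then Im (h (fst y, Complex (snd y $ ?i) (snd y $ ?j))) else snd y $ l)"
      using contw by (cases "l = ?i"; cases "l = ?j") (auto intro!: continuous_intros)
  qed (simp add: plane_suspension_def Let_def)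
  moreover have "H y \<noteq> 0" if y: "y \<in> ?S" for y
  proof
    assume "H y = 0"
    obtain t x where tx: "y = (t, x)" by force
    have z: "plane_suspension (\<lambda>z. h (t, z)) x $ l = 0" for l
      using \<open>H y = 0\<close> by (simp add: H_def tx)
    have "h (t, Complex (x $ ?i) (x $ ?j)) = 0"
      using z[of ?i] z[of ?j] distinct by (simp add: nth Let_def complex_eq_iff)
    then have ij: "x $ ?i = 0" "x $ ?j = 0"
      unfolding nz by (simp_all add: complex_eq_iff)
    have "x $ l = 0" for l
      using z[of l] ij by (cases "l = ?i"; cases "l = ?j") (auto simp: nth Let_def)
    then have "x = 0" by (simp add: vec_eq_iff)
    then show False using y by (simp add: tx)
  qed
  ultimately have cont: "continuous_on ?S (\<lambda>y. sgn (H y))"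
    unfolding sgn_div_norm by (intro continuous_intros) auto
  show ?thesis
    unfolding homotopic_with_def
  proof (rule exI[of _ "\<lambda>y. sgn (H y)"], intro conjI allI ballI)
    have "(\<lambda>y. sgn (H y)) \<in> ?S \<rightarrow> sphere 0 1"
      using \<open>\<And>y. y \<in> ?S \<Longrightarrow> H y \<noteq> 0\<close> by (auto simp: norm_sgn)
    then show "continuous_map (prod_topology (top_of_set {0..1}) (top_of_set (sphere 0 1)))
       (top_of_set (sphere 0 1)) (\<lambda>y. sgn (H y))"
      using cont by (simp add: prod_topology_subtopology_eu continuous_map_subtopology_eu)
  qed (simp_all add: H_def h0 h1)
qed

section \<open>A homogeneous plane map with prescribed periodic rays\<close>

lemma suminf_single:
  fixes f :: "nat \<Rightarrow> 'a::{t2_space, comm_monoid_add}"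
  assumes "\<And>i. i \<noteq> j \<Longrightarrow> f i = 0"
  shows "suminf f = f j"
  using suminf_finite[of "{j}" f] assms by simp

text \<open>At each point at most one term is nonzero, so the \<open>m\<close>-th partial sum misses
  at most one term, of index at least \<open>m\<close>. The convergence is uniform because
  \<open>B\<close> tends to 0.\<close>

lemma continuous_on_suminf_disjoint:
  fixes X :: "nat \<Rightarrow> 'a::topological_space \<Rightarrow> 'b::real_normed_vector"
  assumes cont: "\<And>j. continuous_on S (X j)"
    and disj: "\<And>i j x. X i x \<noteq> 0 \<Longrightarrow> X j x \<noteq> 0 \<Longrightarrow> i = j"
    and bound: "\<And>j x. norm (X j x) \<le> B j" and B: "B \<longlonglongrightarrow> 0"
  shows "continuous_on S (\<lambda>x. suminf (\<lambda>j. X j x))"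
proof (rule uniform_limit_theorem)
  show "\<forall>\<^sub>F m in sequentially. continuous_on S (\<lambda>x. \<Sum>j<m. X j x)"
    by (intro always_eventually allI continuous_on_sum cont)
  show "uniform_limit S (\<lambda>m x. \<Sum>j<m. X j x) (\<lambda>x. suminf (\<lambda>j. X j x)) sequentially"
  proof (rule uniform_limitI)
    fix e :: real assume e: "0 < e"
    obtain M where M: "\<And>j. j \<ge> M \<Longrightarrow> norm (B j) < e"
      using LIMSEQ_D[OF B e] by auto
    show "\<forall>\<^sub>F m in sequentially. \<forall>x\<in>S. dist (\<Sum>j<m. X j x) (suminf (\<lambda>j. X j x)) < e"
    proof (rule eventually_sequentiallyI[of M], rule ballI)
      fix m x assume m: "M \<le> m"
      show "dist (\<Sum>j<m. X j x) (suminf (\<lambda>j. X j x)) < e"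
      proof (cases "\<exists>i. X i x \<noteq> 0")
        case True
        then obtain i where i: "X i x \<noteq> 0" by blast
        have z: "X j x = 0" if "j \<noteq> i" for j
          using disj[OF i] that by blast
        have "(suminf (\<lambda>j. X j x)) = X i x"
          by (rule suminf_single) (rule z)
        moreover have "(\<Sum>j<m. X j x) = (if i < m then X i x else 0)"
        proof (cases "i < m")
          case True
          then have "(\<Sum>j<m. X j x) = (\<Sum>j\<in>{i}. X j x)"
            by (intro sum.mono_neutral_right) (auto simp: z)
          then show ?thesis using True by simp
        qed (auto intro!: sum.neutral z)
        ultimately show ?thesis
          using e bound[of i x] M[of i] m by auto
      qed (use e in auto)
    qed
  qed
qed simp

definition tent :: "real \<Rightarrow> real" where
  "tent x = max 0 (1 - \<bar>x\<bar>)"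

text \<open>Each \<open>j \<in> J\<close> contributes one cycle of invariant rays of exact period \<open>per j\<close>, repelling in the
  angular direction if \<open>sg j = 1\<close> and attracting if \<open>sg j = - 1\<close>.\<close>

locale ray_orbits =
  fixes J :: "nat set" and per :: "nat \<Rightarrow> nat" and sg :: "nat \<Rightarrow> int"
  assumes per_pos: "j \<in> J \<Longrightarrow> per j \<ge> 1"
    and sg: "j \<in> J \<Longrightarrow> sg j = 1 \<or> sg j = - 1"
    and finite_per: "finite {j\<in>J. per j \<le> n}"
begin

text \<open>The intervals of radius \<open>radius j\<close> about these points shrink towards 3/2
  from above.\<close>

definition center :: "nat \<Rightarrow> real" where "center j = 3 / 2 + (1 / 2) ^ j / 4"
definition radius :: "nat \<Rightarrow> real" where "radius j = (1 / 2) ^ j / 64"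
text \<open>The multiplier of the return map to the \<open>j\<close>-th interval;
  \<open>stretch j\<close> is that return map.\<close>

definition slope :: "nat \<Rightarrow> real" where "slope j = (if sg j = 1 then 2 else 1 / 2)"
definition stretch :: "nat \<Rightarrow> real \<Rightarrow> real" where
  "stretch j y = center j + slope j * (y - center j)"

text \<open>The constants anticipate the \<open>per j - 1\<close> doublings that follow: the height
  \<open>2 / 2 ^ per j * stretch j y\<close> grows to \<open>stretch j y\<close>, and the peak gain
  \<open>4 / 2 ^ per j\<close> to a total gain of 2.\<close>

definition piece :: "nat \<Rightarrow> real \<Rightarrow> complex" where
  "piece j y = (if j \<in> J then complex_of_real (4 / 2 ^ per j * tent ((y - center j) / radius j)) *
      Complex 1 (2 / 2 ^ per j * stretch j y) else 0)"

text \<open>Equal to 2 on \<open>[0, 1]\<close> and positive exactly between -1 and 3/2, hence 0 on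
  all the intervals of the pieces.\<close>

definition plateau :: "real \<Rightarrow> real" where
  "plateau y = 2 * max 0 (min 1 (min (1 + y) (3 - 2 * y)))"

definition profile :: "real \<Rightarrow> complex" where
  "profile y = complex_of_real (plateau y) * Complex 1 (2 * y) + (suminf (\<lambda>j. piece j y))"

definition gain :: "real \<Rightarrow> real" where "gain y = Re (profile y)"
text \<open>Where the gain is 0, division by 0 gives direction 0; \<open>total_gain\<close>
  remembers that the ray has collapsed.\<close>

definition dir :: "real \<Rightarrow> real" where "dir y = Im (profile y) / Re (profile y)"

definition ray_map :: "complex \<Rightarrow> complex" where
  "ray_map z = (if Re z > 0 then Re z *\<^sub>R profile (Im z / Re z) else 0)"

definition total_gain :: "nat \<Rightarrow> real \<Rightarrow> real" where
  "total_gain n y = (\<Prod>i<n. gain ((dir ^^ i) y))"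

lemma radius_pos: "radius j > 0" by (simp add: radius_def)

text \<open>Twice the radius, because a repelling \<open>stretch j\<close> doubles its interval and
  the image must still avoid all other intervals.\<close>

lemma center_separated:
  assumes "i < j"
  shows "center j + 2 * radius j < center i - 2 * radius i"
proof -
  have "(1 / 2 :: real) ^ j \<le> (1 / 2) ^ (i + 1)" using assms by (intro power_decreasing) auto
  then have "(1 / 2 :: real) ^ j \<le> (1 / 2) ^ i / 2" by simp
  moreover have "(1 / 2 :: real) ^ i > 0" by simp
  ultimately show ?thesis unfolding center_def radius_def by linarith
qed

lemma near_center:
  assumes "\<bar>y - center j\<bar> < 2 * radius j"
  shows "3 / 2 < y" "y < 2"
proof -
  have "(1 / 2 :: real) ^ j > 0" "(1 / 2 :: real) ^ j \<le> 1" by (simp_all add: power_le_one)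
  then show "3 / 2 < y" "y < 2" using assms unfolding center_def radius_def by linarith+
qed

lemma near_center_unique:
  assumes "\<bar>y - center i\<bar> < 2 * radius i" "\<bar>y - center j\<bar> < 2 * radius j"
  shows "i = j"
proof (rule ccontr)
  assume "i \<noteq> j"
  then consider "i < j" | "j < i" by linarith
  then show False
    using center_separated[of i j] center_separated[of j i] assms by cases linarith+
qed

lemma center_bounds: "3 / 2 < center j" "center j < 2"
  using near_center[of "center j" j] radius_pos[of j] by auto

lemma stretch_near:
  assumes "\<bar>y - center j\<bar> < radius j"
  shows "\<bar>stretch j y - center j\<bar> < 2 * radius j"
  using assms by (auto simp: stretch_def slope_def abs_mult)

lemma piece_eq_0_iff: "piece j y = 0 \<longleftrightarrow> j \<notin> J \<or> \<bar>y - center j\<bar> \<ge> radius j"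
proof -
  have "tent ((y - center j) / radius j) = 0 \<longleftrightarrow> \<bar>y - center j\<bar> \<ge> radius j"
    using radius_pos[of j] by (auto simp: tent_def max_def abs_divide field_simps)
  then show ?thesis by (auto simp: piece_def complex_eq_iff)
qed

lemma piece_disjoint: "piece i y \<noteq> 0 \<Longrightarrow> piece j y \<noteq> 0 \<Longrightarrow> i = j"
  using near_center_unique[of y i j] radius_pos[of i] radius_pos[of j] by (auto simp: piece_eq_0_iff)

lemma norm_piece_le: "norm (piece j y) \<le> (if j \<in> J then 12 / 2 ^ per j else 0)"
proof (cases "piece j y = 0")
  case False
  then have j: "j \<in> J" and y: "\<bar>y - center j\<bar> < radius j"
    by (auto simp: piece_eq_0_iff)
  have s: "3 / 2 < stretch j y" "stretch j y < 2"
    using near_center[OF stretch_near[OF y]] by auto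
  have "(2::real) ^ 1 \<le> 2 ^ per j" using per_pos[OF j] by (intro power_increasing) auto
  then have "2 / 2 ^ per j * stretch j y \<le> 1 * 2"
    using s by (intro mult_mono) auto
  moreover have "cmod (Complex 1 t) \<le> 1 + \<bar>t\<bar>" for t
    using cmod_le[of "Complex 1 t"] by simp
  ultimately have a: "cmod (Complex 1 (2 / 2 ^ per j * stretch j y)) \<le> 3"
    using s by (smt (verit, best) divide_nonneg_nonneg mult_nonneg_nonneg zero_le_power)
  have "\<bar>tent ((y - center j) / radius j)\<bar> \<le> 1"
    by (auto simp: tent_def)
  then have b: "4 / 2 ^ per j * \<bar>tent ((y - center j) / radius j)\<bar> \<le> 4 / 2 ^ per j * 1"
    by (intro mult_left_mono) auto
  have "norm (piece j y) = (4 / 2 ^ per j * \<bar>tent ((y - center j) / radius j)\<bar>) *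
      cmod (Complex 1 (2 / 2 ^ per j * stretch j y))"
    using j by (simp add: piece_def norm_mult abs_mult norm_divide norm_power)
  also have "\<dots> \<le> (4 / 2 ^ per j * 1) * 3"
    by (rule mult_mono[OF b a]) auto
  finally show ?thesis using j by simp
qed auto

text \<open>The pieces have disjoint supports, and by \<open>finite_per\<close> only finitely many
  of the bounds \<open>12 / 2 ^ per j\<close> exceed a given level.\<close>

lemma continuous_on_profile: "continuous_on UNIV profile"
proof -
  have 1: "continuous_on UNIV (\<lambda>y. complex_of_real (plateau y) * Complex 1 (2 * y))"
    unfolding plateau_def Complex_eq by (intro continuous_intros)
  have 2: "continuous_on UNIV (\<lambda>y. suminf (\<lambda>j. piece j y))"
  proof (rule continuous_on_suminf_disjoint)
    show "continuous_on UNIV (piece j)" for j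
    proof (cases "j \<in> J")
      case True
      then have "piece j = (\<lambda>y. complex_of_real (4 / 2 ^ per j * max 0 (1 - \<bar>(y - center j) / radius j\<bar>)) *
          (of_real 1 + \<i> * of_real (2 / 2 ^ per j * (center j + slope j * (y - center j)))))"
        by (simp add: piece_def[abs_def] tent_def stretch_def Complex_eq)
      then show ?thesis
        using radius_pos[of j] by (auto intro!: continuous_intros)
    next
      case False
      then have "piece j = (\<lambda>y. 0)" by (simp add: piece_def[abs_def])
      then show ?thesis by simp
    qed
    show "piece i y \<noteq> 0 \<Longrightarrow> piece j y \<noteq> 0 \<Longrightarrow> i = j" for i j y
      by (rule piece_disjoint)
    show "norm (piece j y) \<le> (if j \<in> J then 12 / 2 ^ per j else 0)" for j y
      by (rule norm_piece_le)
    show "(\<lambda>j. if j \<in> J then 12 / 2 ^ per j else 0 :: real) \<longlonglongrightarrow> 0"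
    proof (rule LIMSEQ_I)
      fix r :: real assume r: "0 < r"
      obtain n where n: "(1 / 2) ^ n < r / 12"
        using real_arch_pow_inv[of "r / 12" "1 / 2"] r by auto
      obtain M where M: "{j\<in>J. per j \<le> n} \<subseteq> {..<M}"
        by (rule exE[OF finite_nat_bounded[OF finite_per[of n]]])
      show "\<exists>M. \<forall>j\<ge>M. norm ((if j \<in> J then 12 / 2 ^ per j else 0) - 0 :: real) < r"
      proof (intro exI[of _ M] allI impI)
        fix j assume j: "M \<le> j"
        show "norm ((if j \<in> J then 12 / 2 ^ per j else 0) - 0 :: real) < r"
        proof (cases "j \<in> J")
          case True
          then have "per j \<le> n \<Longrightarrow> j < M" using M by auto
          then have "n \<le> per j" using j by linarith
          then have "(1 / 2 :: real) ^ per j \<le> (1 / 2) ^ n"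
            by (intro power_decreasing) auto
          then have "12 * (1 / 2) ^ per j < r" using n by linarith
          then show ?thesis using True by (simp add: power_divide)
        qed (use r in auto)
      qed
    qed
  qed
  show ?thesis
    unfolding profile_def[abs_def] by (intro continuous_on_add 1 2)
qed

lemma profile_piece:
  assumes "j \<in> J" "\<bar>y - center j\<bar> < radius j"
  shows "profile y = piece j y"
proof -
  have "3 / 2 < y" using near_center[of y j] assms radius_pos[of j] by auto
  then have "plateau y = 0" by (simp add: plateau_def)
  moreover have "piece j y \<noteq> 0" using assms by (simp add: piece_eq_0_iff)
  then have "(suminf (\<lambda>i. piece i y)) = piece j y"
    by (intro suminf_single) (metis piece_disjoint)
  ultimately show ?thesis by (simp add: profile_def)
qed

lemma profile_no_piece:
  assumes "\<And>j. j \<in> J \<Longrightarrow> \<bar>y - center j\<bar> \<ge> radius j"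
  shows "profile y = complex_of_real (plateau y) * Complex 1 (2 * y)"
proof -
  have "piece j y = 0" for j using assms piece_eq_0_iff by blast
  then show ?thesis by (simp add: profile_def)
qed

lemma gain_dir_piece:
  assumes "j \<in> J" "\<bar>y - center j\<bar> < radius j"
  shows "gain y = 4 / 2 ^ per j * (1 - \<bar>y - center j\<bar> / radius j)" "gain y > 0"
    "dir y = 2 / 2 ^ per j * stretch j y"
proof -
  have t: "tent ((y - center j) / radius j) = 1 - \<bar>y - center j\<bar> / radius j" "\<bar>y - center j\<bar> / radius j < 1"
    using assms radius_pos[of j] by (auto simp: tent_def abs_divide)
  show 1: "gain y = 4 / 2 ^ per j * (1 - \<bar>y - center j\<bar> / radius j)"
    unfolding gain_def profile_piece[OF assms] using assms by (simp add: piece_def t)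
  show 2: "gain y > 0" unfolding 1 using t by simp
  show "dir y = 2 / 2 ^ per j * stretch j y"
    unfolding dir_def profile_piece[OF assms] using assms(1) t(2) by (simp add: piece_def t(1))
qed

lemma profile_low:
  assumes "y \<le> 3 / 2"
  shows "profile y = complex_of_real (plateau y) * Complex 1 (2 * y)"
proof (rule profile_no_piece, rule ccontr)
  fix j assume "\<not> radius j \<le> \<bar>y - center j\<bar>"
  then show False using near_center(1)[of y j] radius_pos[of j] assms by simp
qed

lemma gain_dir_plateau:
  assumes "0 \<le> y" "y \<le> 1"
  shows "gain y = 2" "dir y = 2 * y"
proof -
  have "plateau y = 2" using assms by (simp add: plateau_def)
  then show "gain y = 2" "dir y = 2 * y"
    using profile_low[of y] assms by (simp_all add: gain_def dir_def)
qed

lemma dir_low: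
  assumes "-1 < y" "y < 3 / 2"
  shows "dir y = 2 * y"
proof -
  have "plateau y > 0" using assms by (simp add: plateau_def)
  then show ?thesis using profile_low[of y] assms by (simp add: dir_def)
qed

lemma profile_cases:
  obtains "profile y = 0" | "-1 < y" "y < 3 / 2" "plateau y > 0" "profile y = complex_of_real (plateau y) * Complex 1 (2 * y)"
  | j where "j \<in> J" "\<bar>y - center j\<bar> < radius j"
proof (cases "\<exists>j\<in>J. \<bar>y - center j\<bar> < radius j")
  case False
  then have p: "profile y = complex_of_real (plateau y) * Complex 1 (2 * y)"
    by (intro profile_no_piece) force
  show ?thesis
  proof (cases "plateau y = 0")
    case False
    then have "plateau y > 0" "-1 < y" "y < 3 / 2" by (auto simp: plateau_def max_def min_def split: if_splits)
    then show ?thesis using that(2) p by blast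
  qed (use that(1) p in simp)
qed (use that(3) in blast)

lemma gain_nonneg: "gain y \<ge> 0"
  using gain_dir_piece(2) by (cases y rule: profile_cases) (auto simp: gain_def intro: less_imp_le)

lemma gain_pos_cases:
  assumes "gain y > 0"
  obtains "-1 < y" "y < 3 / 2" | j where "j \<in> J" "\<bar>y - center j\<bar> < radius j"
  using assms that by (cases y rule: profile_cases) (auto simp: gain_def)

text \<open>Valid also where the gain is 0, because the whole vector vanishes there. Thus
  \<open>gain\<close> and \<open>dir\<close> determine \<open>ray_map\<close>.\<close>

lemma profile_eq: "profile y = gain y *\<^sub>R Complex 1 (dir y)"
proof (cases y rule: profile_cases)
  case 1
  then show ?thesis by (simp add: gain_def)
next
  case 2
  then show ?thesis by (simp add: gain_def dir_def complex_eq_iff)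
next
  case (3 j)
  then show ?thesis using gain_dir_piece(2)[OF 3] by (simp add: gain_def dir_def complex_eq_iff)
qed


section \<open>Iterates and continuity of the ray map\<close>

lemma total_gain_0 [simp]: "total_gain 0 y = 1"
  by (simp add: total_gain_def)

lemma total_gain_Suc: "total_gain (Suc n) y = total_gain n y * gain ((dir ^^ n) y)"
  by (simp add: total_gain_def)

lemma total_gain_add: "total_gain (m + n) y = total_gain m y * total_gain n ((dir ^^ m) y)"
proof (induction n)
  case (Suc n)
  have "(dir ^^ n) ((dir ^^ m) y) = (dir ^^ (m + n)) y"
    by (metis add.commute comp_apply funpow_add)
  with Suc show ?case by (simp add: total_gain_Suc)
qed simp

lemma total_gain_nonneg: "total_gain n y \<ge> 0"
  unfolding total_gain_def by (intro prod_nonneg) (auto simp: gain_nonneg)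

lemma ray_map_nonpos [simp]: "Re z \<le> 0 \<Longrightarrow> ray_map z = 0"
  by (simp add: ray_map_def)

lemma ray_map_ray:
  assumes "x \<ge> 0"
  shows "ray_map (x *\<^sub>R Complex 1 y) = (x * gain y) *\<^sub>R Complex 1 (dir y)"
  using assms by (cases "x = 0") (simp_all add: ray_map_def profile_eq)

text \<open>A skew product: directions evolve by \<open>dir\<close> alone, while the gains met on
  the way multiply.\<close>

lemma ray_map_funpow:
  assumes "x \<ge> 0"
  shows "(ray_map ^^ n) (x *\<^sub>R Complex 1 y) = (x * total_gain n y) *\<^sub>R Complex 1 ((dir ^^ n) y)"
proof (induction n)
  case (Suc n)
  have "(ray_map ^^ Suc n) (x *\<^sub>R Complex 1 y) = ray_map ((x * total_gain n y) *\<^sub>R Complex 1 ((dir ^^ n) y))"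
    by (simp add: Suc)
  also have "\<dots> = (x * total_gain n y * gain ((dir ^^ n) y)) *\<^sub>R Complex 1 (dir ((dir ^^ n) y))"
    using assms total_gain_nonneg by (intro ray_map_ray) simp
  finally show ?case by (simp add: total_gain_Suc mult.assoc)
qed simp

lemma ray_map_funpow_nonpos:
  assumes "Re z \<le> 0" "n \<ge> 1"
  shows "(ray_map ^^ n) z = 0"
proof -
  have "(ray_map ^^ m) 0 = 0" for m by (induction m) simp_all
  moreover obtain m where "n = Suc m" using assms(2) by (cases n) auto
  ultimately show ?thesis using assms(1) by (simp add: funpow_swap1)
qed

text \<open>The delicate place is the imaginary axis: \<open>profile\<close> vanishes off
  \<open>{-1..2}\<close> and so is bounded, and the factor \<open>Re z\<close> tends to 0.\<close>

lemma continuous_on_ray_map: "continuous_on UNIV ray_map"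
proof -
  have cp: "isCont profile y" for y
    using continuous_on_profile by (simp add: continuous_on_eq_continuous_at)
  have zero: "profile y = 0" if "y \<notin> {-1..2}" for y
  proof (rule profile_cases[of y])
    fix j assume "\<bar>y - center j\<bar> < radius j"
    then show "profile y = 0" using near_center[of y j] radius_pos[of j] that by simp
  qed (use that in auto)
  have "compact (profile ` {-1..2})"
    using continuous_on_profile by (intro compact_continuous_image) (auto intro: continuous_on_subset)
  then have "bounded (profile ` {-1..2})" by (rule compact_imp_bounded)
  then obtain b where "\<forall>x\<in>profile ` {-1..2}. norm x \<le> b"
    unfolding bounded_iff by (elim exE)
  then have b: "norm (profile y) \<le> \<bar>b\<bar>" for y
    using zero[of y] by (cases "y \<in> {-1..2}") force+
  have "isCont ray_map z" for z
  proof -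
    consider "Re z > 0" | "Re z < 0" | "Re z = 0" by linarith
    then show ?thesis
    proof cases
      case 1
      have "eventually (\<lambda>w. w \<in> {w. Re w > 0}) (nhds z)"
        using 1 by (intro eventually_nhds_in_open) (auto simp: open_halfspace_Re_gt)
      then have ev: "eventually (\<lambda>w. ray_map w = Re w *\<^sub>R profile (Im w / Re w)) (nhds z)"
        by eventually_elim (simp add: ray_map_def)
      have "isCont (\<lambda>w. profile (Im w / Re w)) z"
        by (rule isCont_o2[where f = "\<lambda>w. Im w / Re w", rotated, OF cp]) (use 1 in \<open>auto intro!: continuous_intros\<close>)
      moreover have "isCont Re z" by (simp add: isCont_def tendsto_Re)
      ultimately have "isCont (\<lambda>w. Re w *\<^sub>R profile (Im w / Re w)) z"
        by (intro continuous_intros)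
      then show ?thesis using isCont_cong[OF ev] by simp
    next
      case 2
      have "eventually (\<lambda>w. w \<in> {w. Re w < 0}) (nhds z)"
        using 2 by (intro eventually_nhds_in_open) (auto simp: open_halfspace_Re_lt)
      then have ev: "eventually (\<lambda>w. ray_map w = 0) (nhds z)"
        by eventually_elim simp
      show ?thesis using isCont_cong[OF ev] by simp
    next
      case 3
      have "((\<lambda>w. \<bar>Re w\<bar> * \<bar>b\<bar>) \<longlongrightarrow> \<bar>Re z\<bar> * \<bar>b\<bar>) (at z)"
        by (intro tendsto_intros)
      then have l: "((\<lambda>w. \<bar>Re w\<bar> * \<bar>b\<bar>) \<longlongrightarrow> 0) (at z)" using 3 by simp
      have "norm (ray_map w) \<le> \<bar>Re w\<bar> * \<bar>b\<bar>" for w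
        using b[of "Im w / Re w"]
        by (cases "Re w > 0") (auto simp: ray_map_def mult_left_mono mult_nonpos_nonneg)
      then have "(ray_map \<longlongrightarrow> 0) (at z)"
        by (intro Lim_null_comparison[OF _ l]) (auto intro!: always_eventually)
      then show ?thesis using 3 by (simp add: isCont_def)
    qed
  qed
  then show ?thesis by (simp add: continuous_at_imp_continuous_on)
qed

section \<open>Itineraries of directions\<close>

text \<open>The final height may reach 2, since only the heights before it must lie in
  \<open>[0, 1]\<close>.\<close>

lemma run_plateau:
  assumes "0 \<le> y" "2 ^ i * y \<le> 2"
  shows "(dir ^^ i) y = 2 ^ i * y \<and> total_gain i y = 2 ^ i"
  using assms
proof (induction i)
  case (Suc i)
  have "2 ^ i * y \<le> 1" using Suc.prems by simp
  then have IH: "(dir ^^ i) y = 2 ^ i * y" "total_gain i y = 2 ^ i" and "0 \<le> 2 ^ i * y"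
    using Suc by auto
  then show ?case
    using gain_dir_plateau[of "2 ^ i * y"] \<open>2 ^ i * y \<le> 1\<close> by (simp add: total_gain_Suc)
qed simp

text \<open>The first step drops to a small height; the heights before step \<open>per j\<close> are
  at most 1, so every later step is a doubling with gain 2.\<close>

lemma run_piece:
  assumes j: "j \<in> J" and y: "\<bar>y - center j\<bar> < radius j" and i: "1 \<le> i" "i \<le> per j"
  shows "(dir ^^ i) y = 2 ^ i / 2 ^ per j * stretch j y \<and> total_gain i y = gain y * 2 ^ (i - 1)"
  using i
proof (induction i rule: dec_induct)
  case base
  then show ?case using gain_dir_piece[OF j y] by (simp add: total_gain_Suc)
next
  case (step i)
  have s: "3 / 2 < stretch j y" "stretch j y < 2"
    using near_center[OF stretch_near[OF y]] by auto
  have IH: "(dir ^^ i) y = 2 ^ i / 2 ^ per j * stretch j y" "total_gain i y = gain y * 2 ^ (i - 1)"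
    using step by auto
  have "(2::real) ^ (i + 1) \<le> 2 ^ per j" using step.prems by (intro power_increasing) auto
  then have "2 ^ i / 2 ^ per j \<le> (1 / 2 :: real)" by (simp add: field_simps)
  then have "2 ^ i / 2 ^ per j * stretch j y \<le> 1 / 2 * 2"
    using s by (intro mult_mono) auto
  moreover have "0 \<le> 2 ^ i / 2 ^ per j * stretch j y" using s by simp
  ultimately have "gain ((dir ^^ i) y) = 2" "dir ((dir ^^ i) y) = 2 * (2 ^ i / 2 ^ per j * stretch j y)"
    unfolding IH(1) using gain_dir_plateau[of "2 ^ i / 2 ^ per j * stretch j y"] by auto
  moreover have "(2::real) ^ i = 2 * 2 ^ (i - 1)"
    using step.hyps by (cases i) auto
  ultimately show ?case by (simp add: total_gain_Suc IH(2))
qed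

lemma run_piece_return:
  assumes "j \<in> J" "\<bar>y - center j\<bar> < radius j"
  shows "(dir ^^ per j) y = stretch j y"
  using run_piece[OF assms, of "per j"] per_pos[OF assms(1)] by simp

lemma run_piece_middle:
  assumes j: "j \<in> J" and y: "\<bar>y - center j\<bar> < radius j" and i: "1 \<le> i" "i < per j"
  shows "0 < (dir ^^ i) y" "(dir ^^ i) y \<le> 1"
proof -
  have s: "3 / 2 < stretch j y" "stretch j y < 2"
    using near_center[OF stretch_near[OF y]] by auto
  have "(2::real) ^ (i + 1) \<le> 2 ^ per j" using i by (intro power_increasing) auto
  then have "2 ^ i / 2 ^ per j \<le> (1 / 2 :: real)" by (simp add: field_simps)
  then have "2 ^ i / 2 ^ per j * stretch j y \<le> 1 / 2 * 2"
    using s by (intro mult_mono) auto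
  then show "0 < (dir ^^ i) y" "(dir ^^ i) y \<le> 1"
    using run_piece[OF j y, of i] i s by simp_all
qed

lemma stretch_center [simp]: "stretch j (center j) = center j"
  by (simp add: stretch_def)

lemma funpow_center:
  assumes j: "j \<in> J"
  shows "(dir ^^ (m * per j)) (center j) = center j"
proof (induction m)
  case (Suc m)
  have "(dir ^^ (per j + m * per j)) (center j) = (dir ^^ per j) ((dir ^^ (m * per j)) (center j))"
    by (simp add: funpow_add)
  then show ?case using run_piece_return[OF j, of "center j"] radius_pos[of j] Suc by simp
qed simp

lemma funpow_center_mod:
  assumes j: "j \<in> J"
  shows "(dir ^^ t) (center j) = (dir ^^ (t mod per j)) (center j)"
proof -
  have "(dir ^^ (t mod per j + t div per j * per j)) (center j) = (dir ^^ (t mod per j)) (center j)"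
    unfolding funpow_add using funpow_center[OF j] by simp
  then show ?thesis by simp
qed

lemma funpow_periodic:
  assumes "(f ^^ n) x = x"
  shows "(f ^^ (m * n)) x = x"
  using assms by (induction m) (simp_all add: funpow_add)

lemma two_power_neq_1:
  assumes "n \<ge> 1"
  shows "(2::real) ^ n \<noteq> 1"
proof -
  have "1 < (2::real) ^ n" using assms by (intro one_less_power) auto
  then show ?thesis by linarith
qed

lemma slope_power_neq_1: "n \<ge> 1 \<Longrightarrow> slope j ^ n \<noteq> 1"
  using two_power_neq_1[of n] by (auto simp: slope_def power_divide)

section \<open>Classification of the periodic rays\<close>

text \<open>All gains along the cycle are positive. If the cycle stays between -1 and 3/2, it is a
  cycle of doubling, hence 0. Otherwise it meets the interval of some \<open>j\<close>, and every
  return must land in that interval again; an affine return map of slope different from 1 then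
  leaves only the center.\<close>

lemma periodic_ray_cases:
  assumes n: "n \<ge> 1" and per: "(dir ^^ n) y = y" and pos: "total_gain n y > 0"
  obtains "y = 0" | j i where "j \<in> J" "per j dvd n" "i < per j" "y = center j / 2 ^ i"
proof -
  have gain_pos: "gain ((dir ^^ m) y) > 0" for m
  proof -
    have "(dir ^^ m) y = (dir ^^ (m mod n)) y"
      by (rule funpow_mod_eq[OF per, symmetric])
    moreover have "\<forall>i\<in>{..<n}. gain ((dir ^^ i) y) \<noteq> 0"
      using pos unfolding total_gain_def by (metis finite_lessThan less_irrefl prod_zero)
    then have "gain ((dir ^^ (m mod n)) y) \<noteq> 0"
      using n by simp
    ultimately show ?thesis using gain_nonneg by (metis less_le)
  qed
  show ?thesis
  proof (cases "\<forall>m. -1 < (dir ^^ m) y \<and> (dir ^^ m) y < 3 / 2")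
    case True
    have "(dir ^^ m) y = 2 ^ m * y" for m
    proof (induction m)
      case (Suc m)
      moreover have "dir ((dir ^^ m) y) = 2 * (dir ^^ m) y"
        using True by (intro dir_low) auto
      ultimately show ?case by simp
    qed simp
    then have "(2 ^ n - 1) * y = 0" using per by (simp add: algebra_simps)
    moreover have "(2::real) ^ n \<noteq> 1" using two_power_neq_1[OF n] .
    ultimately show ?thesis using that(1) by simp
  next
    case False
    then obtain m where m: "\<not> (-1 < (dir ^^ m) y \<and> (dir ^^ m) y < 3 / 2)" by blast
    define v where "v = (dir ^^ m) y"
    have gv: "gain ((dir ^^ t) v) > 0" for t
      using gain_pos[of "t + m"] by (simp add: v_def funpow_add)
    have vn: "(dir ^^ n) v = v"
      unfolding v_def by (metis funpow_add add.commute comp_apply per)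
    obtain j where j: "j \<in> J" and vj: "\<bar>v - center j\<bar> < radius j"
      using gain_pos_cases[of v] gv[of 0] m by (auto simp: v_def)
    \<comment> \<open>A return stays within twice the radius of \<open>center j\<close>, a zone
      above 3/2 that no other interval meets; positive gain therefore puts it inside the interval
      itself.\<close>
    have "\<bar>slope j ^ t * (v - center j)\<bar> < radius j \<and> (dir ^^ (t * per j)) v = center j + slope j ^ t * (v - center j)" for t
    proof (induction t)
      case (Suc t)
      let ?w = "(dir ^^ (t * per j)) v"
      have w: "\<bar>?w - center j\<bar> < radius j" using Suc by simp
      have "(dir ^^ (per j + t * per j)) v = (dir ^^ per j) ?w"
        by (simp add: funpow_add)
      also have "\<dots> = stretch j ?w" by (rule run_piece_return[OF j w])
      finally have eq: "(dir ^^ (Suc t * per j)) v = stretch j ?w" by simp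
      then have w2: "\<bar>(dir ^^ (Suc t * per j)) v - center j\<bar> < 2 * radius j"
        using stretch_near[OF w] by simp
      have "\<bar>(dir ^^ (Suc t * per j)) v - center j\<bar> < radius j"
      proof (cases rule: gain_pos_cases[OF gv[of "Suc t * per j"]])
        case 1
        then show ?thesis using near_center(1)[OF w2] by simp
      next
        case (2 i)
        then show ?thesis using near_center_unique[OF _ w2, of i] radius_pos[of i] by simp
      qed
      moreover have "(dir ^^ (Suc t * per j)) v = center j + slope j ^ Suc t * (v - center j)"
        unfolding eq stretch_def using Suc by simp
      ultimately show ?case by simp
    qed (use vj in simp)
    moreover have "(dir ^^ (n * per j)) v = v"
      using funpow_periodic[OF vn, of "per j"] by (simp only: mult.commute)
    ultimately have "v = center j + slope j ^ n * (v - center j)"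
      by metis
    then have "(slope j ^ n - 1) * (v - center j) = 0" by (simp add: algebra_simps)
    then have v: "v = center j" using slope_power_neq_1[OF n, of j] by simp
    \<comment> \<open>Between returns the height is at most 1 whereas the center exceeds 3/2, so
      \<open>per j\<close> is the exact period.\<close>
    have mid: "(dir ^^ r) (center j) \<le> 1" if "1 \<le> r" "r < per j" for r
      using run_piece_middle[OF j _ that, of "center j"] radius_pos[of j] by simp
    have dvd: "per j dvd n"
    proof (rule ccontr)
      assume "\<not> per j dvd n"
      then have "1 \<le> n mod per j" by (simp add: dvd_eq_mod_eq_0 Suc_le_eq)
      moreover have "n mod per j < per j" using per_pos[OF j] by simp
      ultimately have "(dir ^^ (n mod per j)) (center j) \<le> 1" by (rule mid)
      then show False
        using vn funpow_center_mod[OF j, of n] center_bounds[of j] by (simp add: v)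
    qed
    \<comment> \<open>The number of further steps leading from \<open>v\<close> to \<open>y\<close>:
      altogether \<open>m * n\<close> steps, which is \<open>m\<close> full periods.\<close>
    define t where "t = n * m - m"
    have "t + m = m * n" using n by (simp add: t_def mult.commute)
    then have "y = (dir ^^ (t + m)) y" using funpow_periodic[OF per, of m] by simp
    also have "\<dots> = (dir ^^ t) (center j)" by (simp add: funpow_add flip: v_def v)
    also have "\<dots> = (dir ^^ (t mod per j)) (center j)" by (rule funpow_center_mod[OF j])
    finally have y: "y = (dir ^^ (t mod per j)) (center j)" .
    define r where "r = t mod per j"
    have r: "r < per j" using per_pos[OF j] by (simp add: r_def)
    show ?thesis
    proof (cases "r = 0")
      case True
      then show ?thesis using that(2)[of j 0] j dvd y per_pos[OF j] by (simp add: r_def)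
    next
      case False
      have "y = 2 ^ r / 2 ^ per j * center j"
        using run_piece[OF j, of "center j" r] False r y radius_pos[of j] by (simp add: r_def)
      also have "\<dots> = center j / 2 ^ (per j - r)"
        using r by (simp add: power_diff)
      finally show ?thesis using that(2)[of j "per j - r"] j dvd r False by simp
    qed
  qed
qed

section \<open>Local return maps at the invariant rays\<close>

text \<open>Doubling \<open>i\<close> times leads into the \<open>j\<close>-th interval, and the
  remaining \<open>per j - i\<close> steps lead back down. Conjugation by the factor
  \<open>2 ^ i\<close> keeps the slope, so all rays of a cycle have the same type.\<close>

lemma return_near_orbit:
  assumes j: "j \<in> J" and i: "i < per j" and x: "\<bar>2 ^ i * x - center j\<bar> < radius j"
  shows "(dir ^^ per j) x = center j / 2 ^ i + slope j * (x - center j / 2 ^ i)"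
    and "total_gain (per j) x = gain (2 ^ i * x) * 2 ^ (per j - 1)"
proof -
  have b: "3 / 2 < 2 ^ i * x" "2 ^ i * x < 2"
    using near_center[of "2 ^ i * x" j] x radius_pos[of j] by auto
  then have "0 < 2 ^ i * x" by linarith
  then have "0 \<le> x" by (simp add: zero_less_mult_iff)
  with b have run: "(dir ^^ i) x = 2 ^ i * x" "total_gain i x = 2 ^ i"
    using run_plateau[of x i] by auto
  have run': "(dir ^^ (per j - i)) (2 ^ i * x) = 2 ^ (per j - i) / 2 ^ per j * stretch j (2 ^ i * x)"
    "total_gain (per j - i) (2 ^ i * x) = gain (2 ^ i * x) * 2 ^ (per j - i - 1)"
    using run_piece[OF j x, of "per j - i"] i by auto
  have "(dir ^^ (per j - i + i)) x = stretch j (2 ^ i * x) / 2 ^ i"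
    unfolding funpow_add comp_apply run run' using i by (simp add: power_diff)
  also have "\<dots> = center j / 2 ^ i + slope j * (x - center j / 2 ^ i)"
    by (simp add: stretch_def field_simps)
  finally show "(dir ^^ per j) x = center j / 2 ^ i + slope j * (x - center j / 2 ^ i)"
    using i by simp
  have "total_gain (i + (per j - i)) x = 2 ^ i * (gain (2 ^ i * x) * 2 ^ (per j - i - 1))"
    unfolding total_gain_add run run' ..
  also have "\<dots> = gain (2 ^ i * x) * 2 ^ (i + (per j - i - 1))"
    by (simp add: power_add)
  finally show "total_gain (per j) x = gain (2 ^ i * x) * 2 ^ (per j - 1)"
    using i by simp
qed

lemma orbit_periodic:
  assumes j: "j \<in> J" and i: "i < per j"
  shows "(dir ^^ (m * per j)) (center j / 2 ^ i) = center j / 2 ^ i"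
    and "total_gain (m * per j) (center j / 2 ^ i) = 2 ^ m"
proof -
  let ?p = "center j / 2 ^ i"
  have p: "(dir ^^ per j) ?p = ?p"
    using return_near_orbit(1)[OF j i, of ?p] radius_pos[of j] by simp
  \<comment> \<open>The peak gain times \<open>per j - 1\<close> doublings gives gain 2 per round,
    safely above 1.\<close>
  have "gain (center j) = 4 / 2 ^ per j"
    using gain_dir_piece(1)[OF j, of "center j"] radius_pos[of j] by simp
  then have g: "total_gain (per j) ?p = 2"
    using return_near_orbit(2)[OF j i, of ?p] radius_pos[of j] i by (simp add: power_diff)
  show pm: "(dir ^^ (m * per j)) ?p = ?p" for m
    by (rule funpow_periodic[OF p])
  show "total_gain (m * per j) ?p = 2 ^ m"
  proof (induction m)
    case (Suc m)
    have "total_gain (m * per j + per j) ?p = 2 ^ m * 2"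
      unfolding total_gain_add pm g Suc ..
    then show ?case by (simp add: add.commute)
  qed simp
qed

text \<open>A statement about germs: the neighbourhood depends on \<open>m\<close>, as each earlier
  return must still lie close to the cycle.\<close>

lemma eventually_return_near_orbit:
  assumes j: "j \<in> J" and i: "i < per j"
  shows "eventually (\<lambda>x. (dir ^^ (m * per j)) x = center j / 2 ^ i + slope j ^ m * (x - center j / 2 ^ i))
    (nhds (center j / 2 ^ i))"
proof (induction m)
  case (Suc m)
  let ?p = "center j / 2 ^ i"
  have "open {x. \<bar>2 ^ i * (?p + slope j ^ m * (x - ?p)) - center j\<bar> < radius j}"
    by (intro open_Collect_less continuous_intros)
  then have "eventually (\<lambda>x. x \<in> {x. \<bar>2 ^ i * (?p + slope j ^ m * (x - ?p)) - center j\<bar> < radius j}) (nhds ?p)"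
    by (rule eventually_nhds_in_open) (simp add: radius_pos)
  then show ?case
    using Suc
  proof eventually_elim
    case (elim x)
    have "(dir ^^ (per j + m * per j)) x = (dir ^^ per j) (?p + slope j ^ m * (x - ?p))"
      unfolding funpow_add comp_apply elim(2) ..
    also have "\<dots> = ?p + slope j * (?p + slope j ^ m * (x - ?p) - ?p)"
      by (rule return_near_orbit(1)[OF j i]) (use elim(1) in simp)
    finally show ?case by (simp add: mult.assoc)
  qed
qed simp

lemma eventually_dir_near_0: "eventually (\<lambda>x. (dir ^^ n) x = 2 ^ n * x) (nhds 0)"
proof (induction n)
  case (Suc n)
  have "open {x::real. \<bar>2 ^ n * x\<bar> < 1}"
    by (intro open_Collect_less continuous_intros)
  then have "eventually (\<lambda>x. x \<in> {x::real. \<bar>2 ^ n * x\<bar> < 1}) (nhds 0)"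
    by (rule eventually_nhds_in_open) simp
  then show ?case
    using Suc
  proof eventually_elim
    case (elim x)
    then show ?case using dir_low[of "2 ^ n * x"] by simp
  qed
qed simp

end

lemma continuous_on_funpow:
  fixes f :: "'a::topological_space \<Rightarrow> 'a"
  assumes "continuous_on UNIV f"
  shows "continuous_on UNIV (f ^^ n)"
proof (induction n)
  case (Suc n)
  have "continuous_on UNIV (\<lambda>x. f ((f ^^ n) x))"
    by (rule continuous_on_compose2[OF assms Suc]) simp
  then show ?case by (simp add: o_def)
qed (simp add: id_def)

context ray_orbits
begin

section \<open>Winding of the displacement along the rays\<close>

definition orbit_points :: "nat \<Rightarrow> (nat \<times> nat) set" where
  "orbit_points n = (SIGMA j:{j\<in>J. per j dvd n}. {..<per j})"

definition orbit_ray :: "nat \<times> nat \<Rightarrow> real" where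
  "orbit_ray = (\<lambda>(j, i). center j / 2 ^ i)"

lemma orbit_ray_bounds: "0 < orbit_ray x" "orbit_ray x < 2"
proof -
  obtain j i where x: "x = (j, i)" by force
  have "center j / 2 ^ i \<le> center j / 1"
    using center_bounds(1)[of j] by (intro divide_left_mono) auto
  then show "0 < orbit_ray x" "orbit_ray x < 2"
    using center_bounds[of j] by (simp_all add: x orbit_ray_def)
qed

text \<open>All centers lie between 3/2 and 2, so no two differ by a factor of 2 or more; this
  determines \<open>i\<close>, and then \<open>j\<close>.\<close>

lemma inj_orbit_ray: "inj orbit_ray"
proof -
  have le: "i' \<le> i" if eq: "center j / 2 ^ i = center j' / 2 ^ i'" for j i j' i'
  proof (rule ccontr)
    assume "\<not> i' \<le> i"
    then have "center j' = 2 ^ (i' - i) * center j" "(2::real) ^ 1 \<le> 2 ^ (i' - i)"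
      using eq by (simp add: power_diff field_simps) (intro power_increasing, use \<open>\<not> i' \<le> i\<close> in auto)
    moreover from this(2) have "2 ^ 1 * center j \<le> 2 ^ (i' - i) * center j"
      using center_bounds(1)[of j] by (intro mult_right_mono) auto
    ultimately have "2 * center j \<le> center j'" by simp
    then show False
      using center_bounds[of j] center_bounds[of j'] by linarith
  qed
  show ?thesis
  proof (rule injI)
    fix x y assume xy: "orbit_ray x = orbit_ray y"
    obtain j i j' i' where x: "x = (j, i)" and y: "y = (j', i')" by force
    have eq: "center j / 2 ^ i = center j' / 2 ^ i'" using xy by (simp add: x y orbit_ray_def)
    have "i = i'" using le[OF eq] le[OF eq[symmetric]] by simp
    then have "center j = center j'" using eq by simp
    then have "j = j'" using near_center_unique[of "center j" j j'] radius_pos[of j] radius_pos[of j'] by simp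
    with \<open>i = i'\<close> show "x = y" by (simp add: x y)
  qed
qed

lemma finite_orbit_points:
  assumes "n \<ge> 1"
  shows "finite (orbit_points n)"
proof -
  have "finite {j\<in>J. per j dvd n}"
    by (rule finite_subset[OF _ finite_per[of n]]) (use assms in \<open>auto intro: dvd_imp_le\<close>)
  then show ?thesis
    unfolding orbit_points_def by (rule finite_SigmaI) simp
qed

text \<open>\<open>crossing_log\<close> applied to the displacement divided by the point, along the
  line of real part 1. The crossings are the invariant rays; direction 0 contributes the summand 1,
  and each of the \<open>per j\<close> rays of a cycle contributes \<open>sg j\<close>.\<close>

lemma ray_log:
  assumes n: "n \<ge> 1"
  shows "\<exists>Q. continuous_on UNIV Q \<and>
    (\<forall>y. exp (Q y) = 1 - (ray_map ^^ n) (Complex 1 y) / Complex 1 y) \<and>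
    (\<forall>y\<le>-2. Q y = 0) \<and>
    (\<forall>y\<ge>2. Q y = 2 * pi * \<i> * of_int (1 + (\<Sum>j | j \<in> J \<and> per j dvd n. int (per j) * sg j)))"
proof -
  define q where "q y = 1 - (ray_map ^^ n) (Complex 1 y) / Complex 1 y" for y
  define P where "P = insert 0 (orbit_ray ` orbit_points n)"
  define s where "s p = (if p = 0 then 1 else sg (fst (inv_into UNIV orbit_ray p)))" for p
  have q_eq: "q y = 1 - of_real (total_gain n y) * (Complex 1 ((dir ^^ n) y) / Complex 1 y)" for y
    using ray_map_funpow[of 1 n y] by (simp add: q_def scaleR_conv_of_real)
  have pos: "1 + y\<^sup>2 > 0" for y :: real
    by (rule add_pos_nonneg) auto
  \<comment> \<open>Hence \<open>q y\<close> can be real and nonpositive only if direction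
    \<open>y\<close> is fixed with positive total gain, and then \<open>q y\<close> is 1 minus that
    gain. Elsewhere the sign of \<open>Im (q y)\<close> opposes the angular displacement.\<close>
  have Im_q: "Im (q y) = - (total_gain n y * ((dir ^^ n) y - y) / (1 + y\<^sup>2))"
    and Re_q: "Re (q y) = 1 - total_gain n y * (1 + (dir ^^ n) y * y) / (1 + y\<^sup>2)" for y
    by (simp_all add: q_eq Re_divide Im_divide distrib_left right_diff_distrib mult.assoc)
  have q_far: "q y = 1" if "y \<le> - 2 \<or> y \<ge> 2" for y
  proof -
    have "gain y = 0"
    proof (rule ccontr)
      assume "gain y \<noteq> 0"
      then have g: "gain y > 0" using gain_nonneg[of y] by simp
      show False
      proof (rule gain_pos_cases[OF g])
        fix j assume "\<bar>y - center j\<bar> < radius j"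
        then show False using near_center[of y j] radius_pos[of j] that by simp
      qed (use that in auto)
    qed
    then have "total_gain n y = 0"
      unfolding total_gain_def using n by (intro prod_zero) (auto intro!: bexI[of _ 0])
    then show ?thesis by (simp add: q_eq)
  qed
  have per_mult: "\<exists>m\<ge>1. n = m * per j" if "per j dvd n" for j
  proof -
    from \<open>per j dvd n\<close> obtain m where m: "n = per j * m" by (rule dvdE)
    then have "m \<noteq> 0" using n by auto
    then show ?thesis using m by (intro exI[of _ m]) simp
  qed
  obtain Q where Q: "continuous_on UNIV Q" "\<And>\<tau>. exp (Q \<tau>) = q \<tau>"
    "\<And>\<tau>. q \<tau> = 1 \<Longrightarrow> (\<And>p. p \<in> P \<Longrightarrow> \<tau> < p) \<Longrightarrow> Q \<tau> = 0"
    "\<And>\<tau>. q \<tau> = 1 \<Longrightarrow> (\<And>p. p \<in> P \<Longrightarrow> p < \<tau>) \<Longrightarrow> Q \<tau> = 2 * pi * \<i> * of_int (sum s P)"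
  proof (rule crossing_log[of q P s])
    have "continuous_on UNIV (\<lambda>y. Complex 1 y)"
      unfolding Complex_eq by (intro continuous_intros)
    moreover from this have "continuous_on UNIV (\<lambda>y. (ray_map ^^ n) (Complex 1 y))"
      by (rule continuous_on_compose2[OF continuous_on_funpow[OF continuous_on_ray_map]]) simp
    moreover have "Complex 1 y \<noteq> 0" for y by (simp add: complex_eq_iff)
    ultimately show "continuous_on UNIV q"
      unfolding q_def by (intro continuous_on_diff continuous_on_divide continuous_on_const) auto
    show "finite P" unfolding P_def using finite_orbit_points[OF n] by simp
    show "q y \<notin> \<real>\<^sub>\<le>\<^sub>0" if y: "y \<notin> P" for y
    proof
      assume "q y \<in> \<real>\<^sub>\<le>\<^sub>0"
      then have re: "Re (q y) \<le> 0" and im: "Im (q y) = 0"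
        by (auto simp: complex_nonpos_Reals_iff)
      have g: "total_gain n y > 0"
      proof (rule ccontr)
        assume "\<not> total_gain n y > 0"
        then have "total_gain n y = 0" using total_gain_nonneg[of n y] by linarith
        then show False using re by (simp add: Re_q)
      qed
      then have "(dir ^^ n) y = y" using im pos[of y] by (simp add: Im_q)
      then show False
      proof (rule periodic_ray_cases[OF n _ g])
        fix j i assume "j \<in> J" "per j dvd n" "i < per j" "y = center j / 2 ^ i"
        then have "y \<in> orbit_ray ` orbit_points n"
          by (intro image_eqI[of _ _ "(j, i)"]) (auto simp: orbit_ray_def orbit_points_def)
        then show False using y by (simp add: P_def)
      qed (use y in \<open>simp add: P_def\<close>)
    qed
    have s_0: "s 0 = 1" by (simp add: s_def)
    have s_orbit: "s (orbit_ray (j, i)) = sg j" for j i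
      using orbit_ray_bounds(1)[of "(j, i)"] by (simp add: s_def inv_f_f[OF inj_orbit_ray])
    have P_cases: "p = 0 \<or> (\<exists>j i m. j \<in> J \<and> i < per j \<and> m \<ge> 1 \<and> n = m * per j \<and> p = center j / 2 ^ i \<and> s p = sg j)"
      if "p \<in> P" for p
    proof (cases "p = 0")
      case False
      then obtain j i where *: "j \<in> J" "per j dvd n" "i < per j" "p = orbit_ray (j, i)"
        using \<open>p \<in> P\<close> by (auto simp: P_def orbit_points_def)
      then show ?thesis using per_mult[OF *(2)] s_orbit[of j i] by (auto simp: orbit_ray_def)
    qed simp
    show "s p = 1 \<or> s p = - 1" if "p \<in> P" for p
      using P_cases[OF that] sg s_0 by metis
    show "Im (q p) = 0 \<and> Re (q p) < 0" if "p \<in> P" for p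
    proof -
      have "(dir ^^ n) p = p \<and> total_gain n p > 1"
        using P_cases[OF that]
      proof (elim disjE exE conjE)
        assume "p = 0"
        moreover have "1 < (2::real) ^ n" using n by (intro one_less_power) auto
        ultimately show ?thesis using run_plateau[of 0 n] by simp
      next
        fix j i m assume *: "j \<in> J" "i < per j" "m \<ge> 1" "n = m * per j" "p = center j / 2 ^ i"
        have "1 < (2::real) ^ m" using *(3) by (intro one_less_power) auto
        then show ?thesis using orbit_periodic[OF *(1,2), of m] by (simp add: *(4,5))
      qed
      then show ?thesis using pos[of p] by (simp add: Im_q Re_q power2_eq_square)
    qed
    show "eventually (\<lambda>y. of_int (s p) * (y - p) * Im (q y) \<le> 0) (nhds p)" if "p \<in> P" for p
    proof -
      \<comment> \<open>Here \<open>c\<close> is the local multiplier of \<open>dir ^^ n\<close>: at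
        least 1 at a repelling ray, at most 1 at an attracting one.\<close>
      have sign: "of_int (s p) * (y - p) * Im (q y) \<le> 0"
        if "(dir ^^ n) y = p + c * (y - p)" "of_int (s p) * (c - 1) \<ge> 0" for y c
      proof -
        have "(dir ^^ n) y - y = (c - 1) * (y - p)" using that(1) by (simp add: algebra_simps)
        then have "of_int (s p) * (y - p) * Im (q y) =
            - (total_gain n y * ((of_int (s p) * (c - 1)) * (y - p)\<^sup>2) / (1 + y\<^sup>2))"
          by (simp add: Im_q power2_eq_square mult_ac)
        moreover have "total_gain n y * ((of_int (s p) * (c - 1)) * (y - p)\<^sup>2) / (1 + y\<^sup>2) \<ge> 0"
          by (rule divide_nonneg_pos[OF mult_nonneg_nonneg[OF total_gain_nonneg
                mult_nonneg_nonneg[OF that(2) zero_le_power2]] pos])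
        ultimately show ?thesis by linarith
      qed
      show ?thesis
        using P_cases[OF that]
      proof (elim disjE exE conjE)
        assume p: "p = 0"
        have c: "of_int (s p) * ((2::real) ^ n - 1) \<ge> 0" by (simp add: p s_0)
        have "eventually (\<lambda>x. (dir ^^ n) x = p + 2 ^ n * (x - p)) (nhds p)"
          using eventually_dir_near_0[of n] by (simp add: p)
        then show ?thesis
          by eventually_elim (rule sign[OF _ c])
      next
        fix j i m assume *: "j \<in> J" "i < per j" "m \<ge> 1" "n = m * per j" "p = center j / 2 ^ i" "s p = sg j"
        have "slope j ^ m \<ge> 1" if "sg j = 1" using that by (simp add: slope_def)
        moreover have "slope j ^ m \<le> 1" if "sg j = - 1" using that by (simp add: slope_def power_le_one)
        ultimately have c: "of_int (s p) * (slope j ^ m - 1) \<ge> 0" using sg[OF *(1)] *(6) by auto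
        have "eventually (\<lambda>x. (dir ^^ n) x = p + slope j ^ m * (x - p)) (nhds p)"
          using eventually_return_near_orbit[OF *(1,2), of m] by (simp only: *(4,5))
        then show ?thesis
          by eventually_elim (rule sign[OF _ c])
      qed
    qed
  qed (use that in blast)
  have P_bounds: "0 \<le> p" "p < 2" if "p \<in> P" for p
    using that orbit_ray_bounds by (auto simp: P_def less_imp_le)
  have sumP: "sum s P = 1 + (\<Sum>j | j \<in> J \<and> per j dvd n. int (per j) * sg j)"
  proof -
    have fin: "finite {j\<in>J. per j dvd n}"
      by (rule finite_subset[OF _ finite_per[of n]]) (use n in \<open>auto intro: dvd_imp_le\<close>)
    have "0 \<notin> orbit_ray ` orbit_points n" by (metis imageE less_irrefl orbit_ray_bounds(1))
    then have "sum s P = s 0 + sum s (orbit_ray ` orbit_points n)"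
      unfolding P_def using finite_orbit_points[OF n] by simp
    also have "sum s (orbit_ray ` orbit_points n) = (\<Sum>x\<in>orbit_points n. s (orbit_ray x))"
      using inj_orbit_ray by (intro sum.reindex[unfolded o_def]) (auto intro: inj_on_subset)
    also have "\<dots> = (\<Sum>(j, i)\<in>orbit_points n. sg j)"
    proof (rule sum.cong)
      fix x
      have "orbit_ray x \<noteq> 0" using orbit_ray_bounds(1)[of x] by simp
      then show "s (orbit_ray x) = (case x of (j, i) \<Rightarrow> sg j)"
        by (simp add: s_def inv_f_f[OF inj_orbit_ray] case_prod_unfold)
    qed simp
    also have "\<dots> = (\<Sum>j | j \<in> J \<and> per j dvd n. \<Sum>i<per j. sg j)"
      unfolding orbit_points_def by (rule sum.Sigma[symmetric]) (use fin in auto)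
    finally show ?thesis by (simp add: s_def)
  qed
  show ?thesis
  proof (intro exI[of _ Q] conjI allI impI Q(1))
    show "exp (Q y) = 1 - (ray_map ^^ n) (Complex 1 y) / Complex 1 y" for y
      using Q(2) by (simp add: q_def)
    show "Q y = 0" if "y \<le> - 2" for y
    proof (rule Q(3))
      show "q y = 1" using q_far that by simp
      show "y < p" if "p \<in> P" for p using P_bounds[OF that] \<open>y \<le> - 2\<close> by linarith
    qed
    show "Q y = 2 * pi * \<i> * of_int (1 + (\<Sum>j | j \<in> J \<and> per j dvd n. int (per j) * sg j))" if "y \<ge> 2" for y
      unfolding sumP[symmetric]
    proof (rule Q(4))
      show "q y = 1" using q_far that by simp
      show "p < y" if "p \<in> P" for p using P_bounds[OF that] \<open>y \<ge> 2\<close> by linarith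
    qed
  qed
qed

text \<open>Homogeneity reduces the right half plane to points of real part 1; on the rest the
  iterate is 0.\<close>

lemma ray_map_funpow_displacement:
  assumes n: "n \<ge> 1" and "\<And>y. exp (Q y) = 1 - (ray_map ^^ n) (Complex 1 y) / Complex 1 y"
  shows "z - (ray_map ^^ n) z = (if Re z > 0 then z * exp (Q (Im z / Re z)) else z)"
proof (cases "Re z > 0")
  case True
  let ?y = "Im z / Re z"
  have z: "z = Re z *\<^sub>R Complex 1 ?y" using True by (simp add: complex_eq_iff)
  have "(ray_map ^^ n) z = Re z *\<^sub>R (ray_map ^^ n) (Complex 1 ?y)"
    using ray_map_funpow[of "Re z" n ?y] ray_map_funpow[of 1 n ?y] True by (simp flip: z)
  moreover have "Complex 1 ?y \<noteq> 0" by (simp add: complex_eq_iff)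
  then have "z * exp (Q ?y) = z - Re z *\<^sub>R (ray_map ^^ n) (Complex 1 ?y)"
    unfolding assms(2) by (subst (1 2) z) (simp add: scaleR_conv_of_real field_simps)
  ultimately show ?thesis using True by simp
next
  case False
  then show ?thesis using ray_map_funpow_nonpos[OF _ n, of z] by simp
qed

lemma ray_map_scale:
  assumes "r > 0"
  shows "ray_map (r *\<^sub>R z) = r *\<^sub>R ray_map z"
  using assms by (simp add: ray_map_def zero_less_mult_iff)

lemma ray_map_funpow_scale:
  assumes "r > 0"
  shows "(ray_map ^^ n) (r *\<^sub>R z) = r *\<^sub>R (ray_map ^^ n) z"
  by (induction n) (simp_all add: ray_map_scale[OF assms])

end

section \<open>Realising a Dold sequence\<close>

text \<open>Takes \<open>\<bar>b k\<bar>\<close> cycles of period \<open>k\<close>, all with the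
  sign of \<open>b k\<close>, indexed by the codes of pairs \<open>(k, i)\<close>.\<close>

lemma ex_ray_orbits:
  fixes b :: "nat \<Rightarrow> int"
  obtains J per sg where "ray_orbits J per sg"
    "\<And>n. n \<ge> 1 \<Longrightarrow> (\<Sum>j | j \<in> J \<and> per j dvd n. int (per j) * sg j) = (\<Sum>k\<in>{k\<in>{1..n}. k dvd n}. int k * b k)"
proof -
  define per where "per j = fst (prod_decode j)" for j
  define sg where "sg j = sgn (b (per j))" for j
  define J where "J = {j. per j \<ge> 1 \<and> snd (prod_decode j) < nat \<bar>b (per j)\<bar>}"
  \<comment> \<open>\<open>P\<close> is left open since it is used twice: as the true predicate for
    finiteness, as divisibility for the sum.\<close>
  have bij: "bij_betw prod_encode (SIGMA k:{k\<in>{1..n}. P k}. {..<nat \<bar>b k\<bar>}) {j\<in>J. per j \<le> n \<and> P (per j)}" for n P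
  proof (rule bij_betw_byWitness[where f' = prod_decode])
    show "prod_decode ` {j\<in>J. per j \<le> n \<and> P (per j)} \<subseteq> (SIGMA k:{k\<in>{1..n}. P k}. {..<nat \<bar>b k\<bar>})"
    proof (rule image_subsetI)
      fix j assume j: "j \<in> {j\<in>J. per j \<le> n \<and> P (per j)}"
      obtain k i where ki: "prod_decode j = (k, i)" by force
      show "prod_decode j \<in> (SIGMA k:{k\<in>{1..n}. P k}. {..<nat \<bar>b k\<bar>})"
        using j by (simp add: J_def per_def ki)
    qed
  qed (auto simp: J_def per_def)
  have "ray_orbits J per sg"
  proof
    show "j \<in> J \<Longrightarrow> 1 \<le> per j" for j by (simp add: J_def)
    show "j \<in> J \<Longrightarrow> sg j = 1 \<or> sg j = - 1" for j by (auto simp: J_def sg_def sgn_if)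
    show "finite {j \<in> J. per j \<le> n}" for n
      using bij_betw_finite[OF bij[of n "\<lambda>_. True"]] by simp
  qed
  moreover have "(\<Sum>j | j \<in> J \<and> per j dvd n. int (per j) * sg j) = (\<Sum>k\<in>{k\<in>{1..n}. k dvd n}. int k * b k)"
    if n: "n \<ge> 1" for n
  proof -
    have "{j. j \<in> J \<and> per j dvd n} = {j\<in>J. per j \<le> n \<and> per j dvd n}"
      using n by (auto intro: dvd_imp_le)
    then have "(\<Sum>j | j \<in> J \<and> per j dvd n. int (per j) * sg j) =
        (\<Sum>x\<in>(SIGMA k:{k\<in>{1..n}. k dvd n}. {..<nat \<bar>b k\<bar>}). int (per (prod_encode x)) * sg (prod_encode x))"
      using sum.reindex_bij_betw[OF bij[of n "\<lambda>k. k dvd n"], of "\<lambda>j. int (per j) * sg j"] by simp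
    also have "\<dots> = (\<Sum>(k, i)\<in>(SIGMA k:{k\<in>{1..n}. k dvd n}. {..<nat \<bar>b k\<bar>}). int k * sgn (b k))"
      by (intro sum.cong) (auto simp: per_def sg_def)
    also have "\<dots> = (\<Sum>k\<in>{k\<in>{1..n}. k dvd n}. \<Sum>i<nat \<bar>b k\<bar>. int k * sgn (b k))"
      by (rule sum.Sigma[symmetric]) auto
    also have "\<dots> = (\<Sum>k\<in>{k\<in>{1..n}. k dvd n}. int k * b k)"
      by (intro sum.cong) (auto simp: mult.left_commute[of "\<bar>_\<bar>"] abs_mult_sgn)
    finally show ?thesis .
  qed
  ultimately show ?thesis by (rule that)
qed

text \<open>Sending the other coordinates to 0 makes the displacement the identity on them, so it is
  a \<open>plane_suspension\<close>.\<close>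

definition plane_extension :: "(complex \<Rightarrow> complex) \<Rightarrow> real^'n::finite \<Rightarrow> real^'n" where
  "plane_extension g x =
     (let i = fst (idx_pair :: 'n \<times> 'n); j = snd (idx_pair :: 'n \<times> 'n); w = g (Complex (x $ i) (x $ j))
      in \<chi> l. if l = i then Re w else if l = j then Im w else 0)"

text \<open>The case \<open>n = 0\<close> is excluded because \<open>plane_extension id\<close> is
  the projection onto the plane.\<close>

lemma plane_extension_funpow:
  fixes g :: "complex \<Rightarrow> complex"
  assumes distinct: "fst (idx_pair :: 'n::finite \<times> 'n) \<noteq> snd (idx_pair :: 'n \<times> 'n)" and n: "n \<ge> 1"
  shows "(plane_extension g ^^ n :: real^'n \<Rightarrow> real^'n) = plane_extension (g ^^ n)"
  using n
proof (induction n rule: dec_induct)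
  case (step n)
  have "plane_extension g (plane_extension (g ^^ n) x) = (plane_extension (g \<circ> g ^^ n) x :: real^'n)" for x
    using distinct by (simp add: plane_extension_def Let_def vec_eq_iff)
  then show ?case
    by (intro ext) (simp only: funpow.simps(2) step.IH comp_apply[of "plane_extension g"])
qed simp

lemma plane_extension_displacement: "x - plane_extension g x = plane_suspension (\<lambda>z. z - g z) x"
  by (simp add: plane_extension_def plane_suspension_def Let_def vec_eq_iff)

lemma continuous_on_plane_extension:
  assumes "continuous_on UNIV g"
  shows "continuous_on UNIV (plane_extension g :: real^'n::finite \<Rightarrow> real^'n)"
proof -
  let ?i = "fst (idx_pair :: 'n \<times> 'n)" and ?j = "snd (idx_pair :: 'n \<times> 'n)"
  have c: "continuous_on UNIV (\<lambda>x :: real^'n. g (Complex (x $ ?i) (x $ ?j)))"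
    by (rule continuous_on_compose2[OF assms]) (auto simp: Complex_eq intro!: continuous_intros)
  show ?thesis
    unfolding plane_extension_def Let_def
  proof (rule continuous_on_vec_lambda)
    show "continuous_on UNIV (\<lambda>x :: real^'n. if l = ?i then Re (g (Complex (x $ ?i) (x $ ?j)))
        else if l = ?j then Im (g (Complex (x $ ?i) (x $ ?j))) else 0)" for l
      using c by (cases "l = ?i"; cases "l = ?j") (auto intro!: continuous_intros)
  qed
qed

lemma plane_extension_scale:
  assumes "\<And>z. g (r *\<^sub>R z) = r *\<^sub>R g z"
  shows "plane_extension g (r *\<^sub>R x) = r *\<^sub>R plane_extension g x"
proof -
  have "Complex (r * p) (r * q) = r *\<^sub>R Complex p q" for p q by (simp add: complex_eq_iff)
  then show ?thesis by (simp add: plane_extension_def Let_def vec_eq_iff assms)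
qed

lemma norm_std_sphere_map:
  assumes "CARD('n::finite) \<ge> 2"
  shows "norm (std_sphere_map k x) = norm (x :: real^'n)"
proof -
  let ?i = "fst (idx_pair :: 'n \<times> 'n)" and ?j = "snd (idx_pair :: 'n \<times> 'n)"
  let ?w = "plane_pow k (Complex (x $ ?i) (x $ ?j))"
  have ij: "?i \<noteq> ?j" by (rule idx_pair_distinct[OF assms])
  have split: "(\<Sum>l\<in>UNIV. (y $ l)\<^sup>2) = ((y $ ?i)\<^sup>2 + (y $ ?j)\<^sup>2) + (\<Sum>l\<in>- {?i, ?j}. (y $ l)\<^sup>2)" for y :: "real^'n"
    using ij sum.union_disjoint[of "{?i, ?j}" "- {?i, ?j}" "\<lambda>l. (y $ l)\<^sup>2"] by (simp add: Compl_partition)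
  have "(Re ?w)\<^sup>2 + (Im ?w)\<^sup>2 = (cmod (Complex (x $ ?i) (x $ ?j)))\<^sup>2"
    unfolding cmod_power2[symmetric] by simp
  then have "(Re ?w)\<^sup>2 + (Im ?w)\<^sup>2 = (x $ ?i)\<^sup>2 + (x $ ?j)\<^sup>2"
    by (simp add: cmod_power2)
  then have "(\<Sum>l\<in>UNIV. (std_sphere_map k x $ l)\<^sup>2) = (\<Sum>l\<in>UNIV. (x $ l)\<^sup>2)"
    unfolding split using ij by (simp add: std_sphere_map_nth Let_def)
  then show ?thesis by (simp add: norm_vec_def L2_set_def)
qed

context ray_orbits
begin

text \<open>The plane displacement \<open>u\<close> is \<open>z\<close> times an exponential, or
  \<open>z\<close> itself, so it vanishes only at 0 and deforms to
  \<open>plane_pow (?N + 1)\<close>; its suspension deforms to the standard map of degree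
  \<open>?N + 1\<close>.\<close>

lemma ray_map_index:
  assumes card: "CARD('n::finite) \<ge> 2" and n: "n \<ge> 1"
  defines "f \<equiv> plane_extension ray_map :: real^'n \<Rightarrow> real^'n"
  shows "Fix (f ^^ n) = {0}" "fp_index (f ^^ n) 0 = 2 + (\<Sum>j | j \<in> J \<and> per j dvd n. int (per j) * sg j)"
proof -
  let ?i = "fst (idx_pair :: 'n \<times> 'n)" and ?j = "snd (idx_pair :: 'n \<times> 'n)"
  let ?N = "1 + (\<Sum>j | j \<in> J \<and> per j dvd n. int (per j) * sg j)"
  define u where "u z = z - (ray_map ^^ n) z" for z
  have distinct: "?i \<noteq> ?j" by (rule idx_pair_distinct[OF card])
  have fn: "f ^^ n = plane_extension (ray_map ^^ n)"
    unfolding f_def by (rule plane_extension_funpow[OF distinct n])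
  have disp: "x - (f ^^ n) x = plane_suspension u x" for x
    unfolding fn u_def[abs_def] by (rule plane_extension_displacement)
  obtain Q where Q: "continuous_on UNIV Q \<and> (\<forall>y. exp (Q y) = 1 - (ray_map ^^ n) (Complex 1 y) / Complex 1 y) \<and>
    (\<forall>y\<le>-2. Q y = 0) \<and> (\<forall>y\<ge>2. Q y = 2 * pi * \<i> * of_int ?N)"
    using ray_log[OF n] by (elim exE)
  have u_eq: "u z = (if Re z > 0 then z * exp (Q (Im z / Re z)) else z)" for z
    unfolding u_def by (rule ray_map_funpow_displacement[OF n]) (simp add: Q)
  have "\<exists>h :: real \<times> complex \<Rightarrow> complex. continuous_on ({0..1} \<times> UNIV) h \<and> (\<forall>t z. h (t, z) = 0 \<longleftrightarrow> z = 0) \<and>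
    (\<forall>z. h (0, z) = (if Re z > 0 then z * exp (Q (Im z / Re z)) else z)) \<and> (\<forall>z. h (1, z) = plane_pow (?N + 1) z)"
    by (rule plane_homotopy[of Q 2]) (use Q in auto)
  then obtain h :: "real \<times> complex \<Rightarrow> complex" where h: "continuous_on ({0..1} \<times> UNIV) h \<and>
    (\<forall>t z. h (t, z) = 0 \<longleftrightarrow> z = 0) \<and> (\<forall>z. h (0, z) = u z) \<and> (\<forall>z. h (1, z) = plane_pow (?N + 1) z)"
    unfolding u_eq[symmetric] by (elim exE)
  have "homotopic_with_canon (\<lambda>_. True) (sphere 0 1) (sphere 0 1)
      (\<lambda>x :: real^'n. sgn (plane_suspension u x)) (\<lambda>x. sgn (plane_suspension (plane_pow (?N + 1)) x))"
    by (rule homotopic_plane_suspension[OF distinct, of h]) (simp_all add: h)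
  then have hom: "homotopic_with_canon (\<lambda>_. True) (sphere 0 1) (sphere 0 1)
      (\<lambda>x :: real^'n. sgn (plane_suspension u x)) (std_sphere_map (?N + 1))"
    by (rule homotopic_with_eq)
      (auto simp: std_sphere_map_eq[symmetric] norm_std_sphere_map[OF card] sgn_div_norm)
  have ext_0: "plane_extension g 0 = (0 :: real^'n)" if "g 0 = 0" for g
  proof -
    have "Complex 0 0 = 0" by (simp add: complex_eq_iff)
    then show ?thesis using that by (simp add: plane_extension_def Let_def vec_eq_iff)
  qed
  have "x = 0" if "(f ^^ n) x = x" for x
  proof -
    have z: "plane_suspension u x $ l = 0" for l
      using disp[of x] that by (metis right_minus_eq zero_index)
    have "u (Complex (x $ ?i) (x $ ?j)) = 0"
      using z[of ?i] z[of ?j] distinct by (simp add: plane_suspension_def Let_def complex_eq_iff)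
    then have "Complex (x $ ?i) (x $ ?j) = 0"
      by (simp add: u_eq split: if_splits)
    then have "x $ ?i = 0" "x $ ?j = 0" by (simp_all add: complex_eq_iff)
    then have "x $ l = 0" for l
      using z[of l] by (cases "l = ?i"; cases "l = ?j") (auto simp: plane_suspension_def Let_def)
    then show ?thesis by (simp add: vec_eq_iff)
  qed
  moreover have "(f ^^ n) 0 = 0"
    unfolding fn by (rule ext_0) (use ray_map_funpow_nonpos[OF _ n, of 0] in simp)
  ultimately show Fix: "Fix (f ^^ n) = {0}"
    by (auto simp: Fix_def)
  \<comment> \<open>Nothing but positivity is known of the chosen radius; by homogeneity the
    normalised displacement is the same on every sphere about 0.\<close>
  define r where "r = (SOME r. r > 0 \<and> Fix (f ^^ n) \<inter> cball 0 r = {0})"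
  have "r > 0 \<and> Fix (f ^^ n) \<inter> cball 0 r = {0}"
    unfolding r_def by (rule someI[of _ 1]) (simp add: Fix)
  then have r: "r > 0" by simp
  have "(0 + r *\<^sub>R x) - (f ^^ n) (0 + r *\<^sub>R x) = r *\<^sub>R plane_suspension u x" for x
  proof -
    have "(f ^^ n) (r *\<^sub>R x) = r *\<^sub>R (f ^^ n) x"
      unfolding fn by (rule plane_extension_scale) (rule ray_map_funpow_scale[OF r])
    then show ?thesis by (simp add: disp[symmetric] scaleR_diff_right)
  qed
  then have "fp_index (f ^^ n) 0 = sphere_degree (\<lambda>x :: real^'n. sgn (r *\<^sub>R plane_suspension u x))"
    by (simp add: fp_index_def Let_def flip: r_def)
  also have "\<dots> = sphere_degree (\<lambda>x :: real^'n. sgn (plane_suspension u x))"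
    using r by (simp add: sgn_scaleR)
  also have "\<dots> = ?N + 1"
    by (rule sphere_degree_eqI[OF card hom])
  finally show "fp_index (f ^^ n) 0 = 2 + (\<Sum>j | j \<in> J \<and> per j dvd n. int (per j) * sg j)" by simp
qed

end

theorem theorem1:
  fixes I :: "nat \<Rightarrow> int"
  assumes "CARD('n::finite) \<ge> 2"
    and "\<exists>a :: nat \<Rightarrow> int. \<forall>n\<ge>1. I n = (\<Sum>k\<in>{k\<in>{1..n}. k dvd n}. int k * a k)"
  shows "\<exists>f :: real^'n \<Rightarrow> real^'n. continuous_on UNIV f \<and>
           Per f = {0} \<and> Fix f = {0} \<and> (\<forall>n\<ge>1. fp_index (f ^^ n) 0 = I n)"
proof -
  obtain a :: "nat \<Rightarrow> int" where a: "\<And>n. n \<ge> 1 \<Longrightarrow> I n = (\<Sum>k\<in>{k\<in>{1..n}. k dvd n}. int k * a k)"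
    using assms(2) by blast
  \<comment> \<open>The constant 2 in the index of every iterate is a Dold term with
    \<open>k = 1\<close>, so it is absorbed in that coefficient.\<close>
  define b where "b k = a k - (if k = 1 then 2 else 0)" for k
  obtain J per sg where rays: "ray_orbits J per sg"
    and sum: "\<And>n. n \<ge> 1 \<Longrightarrow> (\<Sum>j | j \<in> J \<and> per j dvd n. int (per j) * sg j) = (\<Sum>k\<in>{k\<in>{1..n}. k dvd n}. int k * b k)"
    using ex_ray_orbits[of b] by blast
  interpret ray_orbits J per sg by (rule rays)
  define f :: "real^'n \<Rightarrow> real^'n" where "f = plane_extension ray_map"
  have Fix: "Fix (f ^^ n) = {0}" if "n \<ge> 1" for n
    unfolding f_def by (rule ray_map_index(1)[OF assms(1) that])
  have "fp_index (f ^^ n) 0 = I n" if n: "n \<ge> 1" for n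
  proof -
    have "(\<Sum>k\<in>{k\<in>{1..n}. k dvd n}. int k * b k) =
        (\<Sum>k\<in>{k\<in>{1..n}. k dvd n}. int k * a k - (if k = 1 then 2 else 0))"
      by (intro sum.cong) (auto simp: b_def algebra_simps)
    also have "\<dots> = I n - 2"
      using n by (simp add: sum_subtractf a)
    finally show ?thesis
      unfolding f_def using ray_map_index(2)[OF assms(1) n] sum[OF n] by simp
  qed
  moreover have "Per f = {0}"
    using Fix by (fastforce simp: Per_def Fix_def)
  moreover have "continuous_on UNIV f"
    unfolding f_def by (rule continuous_on_plane_extension[OF continuous_on_ray_map])
  ultimately show ?thesis
    using Fix[of 1] by auto
qed

end
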